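(* The map $\hat\chi\colon\mathbb C^\times\to\widehat{\mathcal P}(\mathbb C)$ defined by $$\hat\chi(z)=\begin{cases}0&\text{if }z=1,\\ \hat\kappa&\text{if }z=-1,\\ \{z^2+0i;0\}&\text{if }\mathrm{Arg}\,z\in(-\tfrac\pi2,\tfrac\pi2]\text{ and }z\neq1,\\ \{z^2+0i;2\}&\text{if }\mathrm{Arg}\,z\notin(-\tfrac\pi2,\tfrac\pi2]\text{ and }z\neq-1\end{cases}$$ is a group homomorphism, and the sequence $$0\longrightarrow\mathbb C^\times\xrightarrow{\ \hat\chi\ }\widehat{\mathcal P}(\mathbb C)\longrightarrow\mathcal P(\mathbb C)\longrightarrow0$$ is exact and split, where the right arrow is induced by $\hat\pi\colon(z;2p,2q)\mapsto z$.
   Context: Let $\mathbb C_{\mathrm{cut}}=\mathbb C\setminus((-\infty,0]\cup[1,\infty))$ and let $\overline{\mathbb C}_{\mathrm{cut}}$ be $\mathbb C_{\mathrm{cut}}$ together with, for each $x\in(-\infty,0)\cup(1,\infty)$, two boundary points $x\pm0i=\lim_{t\searrow0}(x\pm ti)$; for a complex number $w$, $w+0i$ denotes the upper boundary point if $w\in(-\infty,0)\cup(1,\infty)$ and $w$ itself otherwise. The principal branches of $\mathrm{Log}$, $\mathrm{Li}_2$ and $\mathrm{Arg}$ (with $\mathrm{Arg}\in(-\pi,\pi]$ on $\mathbb C^\times$) are extended to $\overline{\mathbb C}_{\mathrm{cut}}$ by continuity from the respective side. Let $\widehat{\mathbb C}$ be the quotient of $\overline{\mathbb C}_{\mathrm{cut}}\times(2\mathbb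 Z)^2$ by $(x+0i,2p,2q)\sim(x-0i,2p+2,2q)$ for $x\in(-\infty,0)$ and $(x+0i,2p,2q)\sim(x-0i,2p,2q+2)$ for $x\in(1,\infty)$ ($p,q\in\mathbb Z$); classes are written $(z;2p,2q)$, and $\hat\pi(z;2p,2q)=z\in\mathbb C\setminus\{0,1\}$. Let $\mathrm{FT}=\{(x,y,\tfrac yx,\tfrac{1-1/x}{1-1/y},\tfrac{1-x}{1-y}) : x\neq y\in\mathbb C\setminus\{0,1\}\}$, $\mathrm{FT}^+$ the subset where all five entries have positive imaginary part, and $\widehat{\mathrm{FT}}$ the connected component of $\hat\pi^{-1}(\mathrm{FT})\subset\widehat{\mathbb C}^5$ containing all $((z_0;0,0),\dots,(z_4;0,0))$ with $(z_0,\dots,z_4)\in\mathrm{FT}^+$. The extended pre-Bloch group $\widehat{\mathcal P}(\mathbb C)$ is the quotient of the free abelian group $\mathbb Z[\widehat{\mathbb C}]$ by the subgroup generated by all $\sum_{k=0}^4(-1)^k[\hat z_k]$ with $(\hat z_0,\dots,\hat z_4)\in\widehat{\mathrm{FT}}$; the image of $(z;2p,2q)$ is denoted $[z;2p,2q]$. The pre-Bloch group $\mathcal P(\mathbb C)$ is the quotient of $\mathbb Z[\mathbb C\setminus\{0,1\}]$ by the subgroup generated by $[z_0]-[z_1]+[z_2]-[z_3]+[z_4]$ for $(z_0,\dots,z_4)\in\mathrm{FT}$. For $z\in\overline{\mathbb C}_{\mathrm{cut}}$ and $p\in\mathbb Z$ put $\{z;2p\}=[z;2p,2]-[z;2p,0]$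 (in $\widehat{\mathcal P}(\mathbb C)$ this equals $[z;2p,2q]-[z;2p,2q-2]$ for every $q$), and let $\hat\kappa=\{z;2p\}-\{z;2p-2\}$, an element of $\widehat{\mathcal P}(\mathbb C)$ independent of $z\in\mathbb C\setminus\{0,1\}$ and $p\in\mathbb Z$. *)

theory Defs
  imports "HOL-Analysis.Analysis" "HOL-Algebra.Free_Abelian_Groups" "HOL-Algebra.Coset"
begin

definition C_cut :: "complex set" where
  "C_cut = {z. \<not> (Im z = 0 \<and> (Re z \<le> 0 \<or> Re z \<ge> 1))}"

text \<open>Points of the closed cut plane: (z,0) for z in C_cut; (x,1) = x+0i and (x,-1) = x-0i
  for real x in (-infinity,0) union (1,infinity).\<close>
definition Cbar_cut :: "(complex \<times> int) set" where
  "Cbar_cut = {(z, 0) | z. z \<in> C_cut}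
     \<union> {(complex_of_real x, s) | x s. (x < 0 \<or> x > 1) \<and> (s = 1 \<or> s = -1)}"

definition plus0i :: "complex \<Rightarrow> complex \<times> int" where
  "plus0i w = (if w \<in> C_cut then (w, 0) else (w, 1))"

text \<open>Principal Log z and Log(1-z), extended to the boundary points by continuity from the
  respective side (Ln is the principal branch, Im in (-pi,pi]).\<close>
definition LogB :: "complex \<times> int \<Rightarrow> complex" where
  "LogB w = (if snd w = -1 \<and> Re (fst w) < 0 then Ln (fst w) - 2 * pi * \<i> else Ln (fst w))"

definition Log1B :: "complex \<times> int \<Rightarrow> complex" where
  "Log1B w = (if snd w = 1 \<and> Re (fst w) > 1 then Ln (1 - fst w) - 2 * pi * \<i> else Ln (1 - fst w))"

text \<open>The class (z;2p,2q) of C-hat, realised (via its log coordinates) as the point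
  (Log z + 2 pi i p, Log(1-z) - 2 pi i q) of C^2.  Two elements of Cbar_cut x (2Z)^2 have
  the same image iff they are identified by the gluing relation, and the quotient topology
  is the subspace topology of C^2.\<close>
definition hat :: "complex \<times> int \<Rightarrow> int \<Rightarrow> int \<Rightarrow> complex \<times> complex" where
  "hat w p q = (LogB w + 2 * pi * \<i> * of_int p, Log1B w - 2 * pi * \<i> * of_int q)"

definition Chat :: "(complex \<times> complex) set" where
  "Chat = {hat w p q | w p q. w \<in> Cbar_cut}"

definition pihat :: "complex \<times> complex \<Rightarrow> complex" where
  "pihat u = exp (fst u)"

definition FT :: "(complex ^ 5) set" where
  "FT = {vector [x, y, y / x, (1 - 1 / x) / (1 - 1 / y), (1 - x) / (1 - y)] | x y.
           x \<noteq> y \<and> x \<notin> {0, 1} \<and> y \<notin> {0, 1}}"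

definition FT_plus :: "(complex ^ 5) set" where
  "FT_plus = {v \<in> FT. \<forall>i. Im (v $ i) > 0}"

definition FT_lift :: "((complex \<times> complex) ^ 5) set" where
  "FT_lift = {w. (\<forall>i. w $ i \<in> Chat) \<and> (\<chi> i. pihat (w $ i)) \<in> FT}"

text \<open>The component of FT_lift containing all ((z0;0,0),...,(z4;0,0)) with (z0,...,z4) in FT+.\<close>
definition FT_hat :: "((complex \<times> complex) ^ 5) set" where
  "FT_hat = \<Union> {connected_component_set FT_lift (\<chi> i. hat (v $ i, 0) 0 0) | v. v \<in> FT_plus}"

text \<open>Indices of type 5: vector [a0,...,a4] has entries a0,...,a4 at the positions
  1,2,3,4,5 (where 5 = 0 in the numeral type 5).\<close>
definition five_term :: "'a ^ 5 \<Rightarrow> 'a \<Rightarrow>\<^sub>0 int" where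
  "five_term w = frag_of (w $ 1) - frag_of (w $ 2) + frag_of (w $ 3) - frag_of (w $ 4)
                 + frag_of (w $ 5)"

lemma five_term_vector:
  "five_term (vector [a0, a1, a2, a3, a4] :: complex ^ 5)
     = frag_of a0 - frag_of a1 + frag_of a2 - frag_of a3 + frag_of a4"
  by (simp add: five_term_def vector_def)

definition Zhat :: "(complex \<times> complex \<Rightarrow>\<^sub>0 int) monoid" where
  "Zhat = free_Abelian_group Chat"

definition Rhat :: "(complex \<times> complex \<Rightarrow>\<^sub>0 int) set" where
  "Rhat = generate Zhat (five_term ` FT_hat)"

definition Phat :: "(complex \<times> complex \<Rightarrow>\<^sub>0 int) set monoid" where
  "Phat = Zhat Mod Rhat"

definition ZP :: "(complex \<Rightarrow>\<^sub>0 int) monoid" where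
  "ZP = free_Abelian_group (UNIV - {0, 1})"

definition RP :: "(complex \<Rightarrow>\<^sub>0 int) set" where
  "RP = generate ZP (five_term ` FT)"

definition PB :: "(complex \<Rightarrow>\<^sub>0 int) set monoid" where
  "PB = ZP Mod RP"

definition Cx :: "complex monoid" where
  "Cx = \<lparr>carrier = UNIV - {0}, monoid.mult = (*), one = 1\<rparr>"

text \<open>Representative in Z[C-hat] of {z;2p} = [z;2p,2] - [z;2p,0].\<close>
definition curly :: "complex \<times> int \<Rightarrow> int \<Rightarrow> complex \<times> complex \<Rightarrow>\<^sub>0 int" where
  "curly w p = frag_of (hat w p 1) - frag_of (hat w p 0)"

text \<open>Representative of kappa-hat = {z;2p} - {z;2p-2} (taking z = 1/2, p = 0).\<close>
definition kappa_rep :: "complex \<times> complex \<Rightarrow>\<^sub>0 int" where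
  "kappa_rep = curly (1/2, 0) 0 - curly (1/2, 0) (-1)"

definition chi_rep :: "complex \<Rightarrow> complex \<times> complex \<Rightarrow>\<^sub>0 int" where
  "chi_rep z =
     (if z = 1 then 0
      else if z = -1 then kappa_rep
      else if - (pi / 2) < Arg z \<and> Arg z \<le> pi / 2 then curly (plus0i (z ^ 2)) 0
      else curly (plus0i (z ^ 2)) 1)"

definition chi_hat :: "complex \<Rightarrow> (complex \<times> complex \<Rightarrow>\<^sub>0 int) set" where
  "chi_hat z = Rhat #>\<^bsub>Zhat\<^esub> chi_rep z"

definition pihat_free :: "(complex \<times> complex \<Rightarrow>\<^sub>0 int) \<Rightarrow> (complex \<Rightarrow>\<^sub>0 int)" where
  "pihat_free = frag_extend (\<lambda>u. frag_of (pihat u))"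

definition pihat_star :: "(complex \<times> complex \<Rightarrow>\<^sub>0 int) set \<Rightarrow> (complex \<Rightarrow>\<^sub>0 int) set" where
  "pihat_star X = RP #>\<^bsub>ZP\<^esub> pihat_free (SOME x. x \<in> X)"

end

theory Submission
  imports Defs "HOL-Real_Asymp.Real_Asymp" "HOL-Complex_Analysis.Cauchy_Integral_Theorem"
begin

text \<open>
  In the coordinates \<open>(u, v) = (log z, log (1 - z))\<close> the lifted five-term relations form exactly the
  set cut out by \<open>u\<^sub>2 = u\<^sub>1 - u\<^sub>0\<close>, \<open>u\<^sub>3 = u\<^sub>2 + u\<^sub>4\<close>, \<open>u\<^sub>4 = v\<^sub>0 - v\<^sub>1\<close>, \<open>v\<^sub>3 = v\<^sub>2 - v\<^sub>1\<close>,
  \<open>v\<^sub>4 = v\<^sub>3 + u\<^sub>0\<close>: this set is the cover of \<open>{(x, y). x \<noteq> y, x, y \<noteq> 0, 1}\<close> on which \<open>x\<close>, \<open>1 - x\<close>,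
  \<open>y\<close>, \<open>1 - y\<close>, \<open>x - y\<close> have logarithms, and it is connected because for each of these five functions
  there is a loop that winds once around its zero divisor and along which the other four have
  logarithms.

  Shifting single logarithms by \<open>2 \<pi> \<i>\<close> in the five-term relation shows that
  \<open>\<Delta> u = [u, v - 2 \<pi> \<i>] - [u, v]\<close> does not depend on \<open>v\<close> and is additive in \<open>u\<close>, and that
  \<open>[u + 2 \<pi> \<i>, v] - [u, v] = \<Delta> v\<close>. Going around a square of shifts gives \<open>\<Delta> (4 \<pi> \<i>) = 0\<close>.
  Hence \<open>z \<mapsto> \<Delta> (2 log z)\<close> is a homomorphism; it is the map of the theorem, and its image contains the
  differences of any two lifts of a point, which gives exactness in the middle.

  A left inverse is the exponential of the Rogers dilogarithm divided by \<open>2 \<pi> \<i>\<close>: it is single-valued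
  on the cover, it satisfies the five-term relation up to a constant because its logarithmic
  derivative is \<open>(u dv - v du) / (4 \<pi> \<i>)\<close>, and it is multiplied by \<open>exp (u / 2)\<close> under
  \<open>v \<mapsto> v - 2 \<pi> \<i>\<close>. The splitting on the other side follows formally.
\<close>

section \<open>Covers defined by logarithms\<close>

text \<open>Each fibre is a torsor under the vectors with entries in 2 pi i Z. The base point is
  kept in the pair so that the projection to the base is available.\<close>

definition log_cover :: "'b set \<Rightarrow> ('n \<Rightarrow> 'b \<Rightarrow> complex) \<Rightarrow> ('b \<times> (complex ^ 'n)) set" where
  "log_cover Y f = {(y, w). y \<in> Y \<and> (\<forall>j. exp (w $ j) = f j y)}"

lemma log_cover_iff: "(y, w) \<in> log_cover Y f \<longleftrightarrow> y \<in> Y \<and> (\<forall>j. exp (w $ j) = f j y)"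
  by (simp add: log_cover_def)

lemma norm_minus_one_less_imp_notin_nonpos_Reals:
  fixes z :: complex
  assumes "norm (z - 1) < 1"
  shows "z \<notin> \<real>\<^sub>\<le>\<^sub>0"
proof
  assume "z \<in> \<real>\<^sub>\<le>\<^sub>0"
  then have "Re z \<le> 0" by (auto elim: nonpos_Reals_cases)
  moreover have "\<bar>Re (z - 1)\<bar> < 1"
    using abs_Re_le_cmod[of "z - 1"] assms by linarith
  ultimately show False by simp
qed

locale log_cover_base =
  fixes Y :: "'b :: real_normed_vector set" and f :: "'n :: finite \<Rightarrow> 'b \<Rightarrow> complex"
  assumes open_base: "open Y"
    and cont: "\<And>j. continuous_on Y (f j)"
    and nz: "\<And>j y. y \<in> Y \<Longrightarrow> f j y \<noteq> 0"
begin

abbreviation "M \<equiv> log_cover Y f"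

text \<open>By continuity each quotient stays within distance 1 of 1 near \<open>y0\<close>, and
  finiteness of the index type gives a common radius. On this ball the principal logarithms of the
  quotients are continuous, which trivialises the cover.\<close>

lemma local_ball:
  assumes "y0 \<in> Y"
  obtains d where "d > 0" "ball y0 d \<subseteq> Y"
    "\<And>y j. y \<in> ball y0 d \<Longrightarrow> f j y / f j y0 \<notin> \<real>\<^sub>\<le>\<^sub>0"
proof -
  have "\<exists>d>0. ball y0 d \<subseteq> Y \<and> (\<forall>y\<in>ball y0 d. f j y / f j y0 \<notin> \<real>\<^sub>\<le>\<^sub>0)" for j
  proof -
    obtain e where e: "e > 0" "ball y0 e \<subseteq> Y"
      using open_base assms openE by blast
    have "norm (f j y0) > 0" using nz[OF assms] by simp
    then obtain e' where e': "e' > 0" "\<And>y. y \<in> Y \<Longrightarrow> dist y y0 < e' \<Longrightarrow> dist (f j y) (f j y0) < norm (f j y0)"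
      using cont[of j] assms unfolding continuous_on_iff by metis
    have "f j y / f j y0 \<notin> \<real>\<^sub>\<le>\<^sub>0" if "y \<in> ball y0 (min e e')" for y
    proof (rule norm_minus_one_less_imp_notin_nonpos_Reals)
      have "y \<in> Y" "dist y y0 < e'" using that e by (auto simp: dist_commute)
      then have "norm (f j y - f j y0) < norm (f j y0)" using e' by (auto simp: dist_norm)
      moreover have "f j y / f j y0 - 1 = (f j y - f j y0) / f j y0"
        using nz[OF assms] by (simp add: field_simps)
      ultimately show "norm (f j y / f j y0 - 1) < 1"
        using nz[OF assms] by (simp add: norm_divide)
    qed
    then show ?thesis using e e' by (intro exI[of _ "min e e'"]) auto
  qed
  then obtain D where D: "\<And>j. D j > 0" "\<And>j. ball y0 (D j) \<subseteq> Y"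
     "\<And>j y. y \<in> ball y0 (D j) \<Longrightarrow> f j y / f j y0 \<notin> \<real>\<^sub>\<le>\<^sub>0" by metis
  define d where "d = Min (range D)"
  have dle: "d \<le> D j" for j by (simp add: d_def)
  have "d > 0" using D(1) by (simp add: d_def)
  moreover have "ball y0 d \<subseteq> ball y0 (D j)" for j by (rule subset_ball[OF dle])
  ultimately show thesis using D(2,3) that[of d] by blast
qed

text \<open>Adding to \<open>w\<close> the change of the principal logarithms of
  \<open>f j z / f j y0\<close> gives a continuous section through \<open>(y, w)\<close>; its image
  is connected and meets every fibre over the ball.\<close>

lemma section_connected:
  assumes ball: "ball y0 d \<subseteq> Y" "\<And>y j. y \<in> ball y0 d \<Longrightarrow> f j y / f j y0 \<notin> \<real>\<^sub>\<le>\<^sub>0"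
    and y0: "y0 \<in> Y" and yw: "(y, w) \<in> M" "y \<in> ball y0 d" and y': "y' \<in> ball y0 d"
  shows "\<exists>w'. connected_component M (y, w) (y', w')"
proof -
  define s where "s = (\<lambda>z. (z, (\<chi> j. w $ j + (Ln (f j z / f j y0) - Ln (f j y / f j y0)))))"
  have "continuous_on (ball y0 d) s"
    unfolding s_def using ball nz[OF y0]
    by (intro continuous_intros continuous_on_subset[OF cont]) auto
  then have "connected (s ` ball y0 d)"
    by (intro connected_continuous_image) auto
  moreover have "s ` ball y0 d \<subseteq> M"
  proof -
    have "y \<in> Y" using yw ball by auto
    have "exp (w $ j + (Ln (f j z / f j y0) - Ln (f j y / f j y0))) = f j z" if "z \<in> ball y0 d" for z j
    proof -
      have "exp (w $ j) = f j y" using yw by (simp add: log_cover_iff)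
      moreover have "z \<in> Y" using that ball by auto
      ultimately show ?thesis using nz[OF y0] nz[OF \<open>y \<in> Y\<close>] nz[of z]
        by (simp add: exp_add exp_diff)
    qed
    then show ?thesis using ball by (auto simp: s_def log_cover_iff)
  qed
  moreover have "s y = (y, w)" by (simp add: s_def vec_eq_iff)
  moreover have "s y' = (y', snd (s y'))" by (simp add: s_def)
  ultimately show ?thesis using yw(2) y'
    by (metis connected_componentI imageI)
qed

text \<open>Over small balls this is \<open>section_connected\<close>; connectedness of the base
  propagates it, once it is taken in both directions so as to be symmetric.\<close>

lemma component_surj:
  assumes Y: "connected Y" and "y \<in> Y" "y' \<in> Y" and yw: "(y, w) \<in> M"
  shows "\<exists>w'. connected_component M (y, w) (y', w')"
proof -
  define Q where "Q = (\<lambda>y y'. \<forall>w. (y, w) \<in> M \<longrightarrow> (\<exists>w'. connected_component M (y, w) (y', w')))"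
  have Qtrans: "Q x z" if "Q x y" "Q y z" for x y z
    unfolding Q_def
  proof (intro allI impI)
    fix w assume "(x, w) \<in> M"
    then obtain w' where 1: "connected_component M (x, w) (y, w')" using \<open>Q x y\<close> by (auto simp: Q_def)
    then have "(y, w') \<in> M" using connected_component_in by blast
    then obtain w'' where "connected_component M (y, w') (z, w'')" using \<open>Q y z\<close> by (auto simp: Q_def)
    then show "\<exists>w'. connected_component M (x, w) (z, w')" using 1 connected_component_trans by blast
  qed
  have "Q y y' \<and> Q y' y"
  proof (rule connected_equivalence_relation[OF Y \<open>y \<in> Y\<close> \<open>y' \<in> Y\<close>, where R = "\<lambda>y y'. Q y y' \<and> Q y' y"])
    fix a assume a: "a \<in> Y"
    obtain d where d: "d > 0" "ball a d \<subseteq> Y" "\<And>y j. y \<in> ball a d \<Longrightarrow> f j y / f j a \<notin> \<real>\<^sub>\<le>\<^sub>0"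
      using local_ball[OF a] by blast
    have "Q x z" if "x \<in> ball a d" "z \<in> ball a d" for x z
      unfolding Q_def using section_connected[OF d(2,3) a] that by blast
    then have "\<forall>x\<in>ball a d. Q a x \<and> Q x a" using d by auto
    moreover have "openin (top_of_set Y) (ball a d)" using d by (simp add: open_base open_subset)
    ultimately show "\<exists>T. openin (top_of_set Y) T \<and> a \<in> T \<and> (\<forall>x\<in>T. Q a x \<and> Q x a)"
      using d(1) by (meson centre_in_ball)
  qed (use Qtrans in blast)+
  then show ?thesis using yw by (auto simp: Q_def)
qed

text \<open>Adding \<open>n\<close> is a deck transformation, hence a continuous self-map of the
  cover.\<close>

lemma translate_component:
  assumes "connected_component M (y, w) (y', w')" and n: "\<And>j. exp (n $ j) = 1"
  shows "connected_component M (y, w + n) (y', w' + n)"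
proof -
  obtain T where T: "connected T" "T \<subseteq> M" "(y, w) \<in> T" "(y', w') \<in> T"
    using assms unfolding connected_component_def by blast
  define t where "t = (\<lambda>p::'b \<times> (complex ^ 'n). (fst p, snd p + n))"
  have "connected (t ` T)"
    unfolding t_def by (intro connected_continuous_image continuous_intros T)
  moreover have "t ` T \<subseteq> M" using T(2) n by (auto simp: t_def log_cover_iff exp_add)
  moreover have "(y, w + n) \<in> t ` T" using T(3) by (force simp: t_def)
  moreover have "(y', w' + n) \<in> t ` T" using T(4) by (force simp: t_def)
  ultimately show ?thesis by (auto intro: connected_componentI)
qed

text \<open>The deck group is generated by the translations by 2 pi i in one coordinate. A path
  realising each generator at a single place of the cover suffices, because conjugation by paths
  carries it to every fibre.\<close>

lemma connected_log_cover:
  assumes Y: "connected Y"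
    and loops: "\<And>j. \<exists>y w. connected_component M (y, w) (y, w + axis j (2 * pi * \<i>))"
  shows "connected M"
proof -
  have step1: "connected_component M (y, w) (y, w + axis j (2 * pi * \<i>))" if yw: "(y, w) \<in> M" for y w j
  proof -
    let ?e = "axis j (2 * pi * \<i>) :: complex ^ 'n"
    have e: "exp (?e $ i) = 1" for i by (simp add: axis_def)
    obtain y' w' where l: "connected_component M (y', w') (y', w' + ?e)" using loops by blast
    then have y': "(y', w') \<in> M" using connected_component_in by blast
    obtain w1 where w1: "connected_component M (y, w) (y', w1)"
      using component_surj[OF Y _ _ yw, of y'] yw y' unfolding log_cover_iff by blast
    then have "(y', w1) \<in> M" using connected_component_in by blast
    \<comment> \<open>Both \<open>w1\<close> and \<open>w'\<close> exponentiate to the values of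
      \<open>f\<close> at \<open>y'\<close>, so \<open>w1 - w'\<close> is a deck transformation; it
      moves the given path to start at \<open>w1\<close>.\<close>
    then have "connected_component M (y', w' + (w1 - w')) (y', w' + ?e + (w1 - w'))"
      using y' nz by (intro translate_component[OF l]) (auto simp: log_cover_iff exp_diff)
    then have "connected_component M (y', w1) (y', w1 + ?e)" by (simp add: algebra_simps)
    moreover have "connected_component M (y', w1 + ?e) (y, w + ?e)"
      using translate_component[OF w1 e] connected_component_sym by blast
    ultimately show ?thesis using w1 connected_component_trans by blast
  qed
  have nat1: "connected_component M (y, w) (y, w + axis j (2 * pi * \<i> * of_nat m))" if "(y, w) \<in> M" for y w j m
  proof (induction m)
    case 0 then show ?case using that by (simp add: axis_def flip: zero_vec_def)
  next
    case (Suc m)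
    then have "(y, w + axis j (2 * pi * \<i> * of_nat m)) \<in> M" using connected_component_in by blast
    from step1[OF this, of j] Suc
    have "connected_component M (y, w) (y, w + axis j (2 * pi * \<i> * of_nat m) + axis j (2 * pi * \<i>))"
      using connected_component_trans by blast
    moreover have "w + axis j (2 * pi * \<i> * of_nat m) + axis j (2 * pi * \<i>) = w + axis j (2 * pi * \<i> * of_nat (Suc m))"
      by (simp add: vec_eq_iff axis_def algebra_simps)
    ultimately show ?case by metis
  qed
  have int1: "connected_component M (y, w) (y, w + axis j (2 * pi * \<i> * of_int m))" if yw: "(y, w) \<in> M" for y w j m
  proof (cases "m \<ge> 0")
    case True then show ?thesis using nat1[OF yw, of j "nat m"] by simp
  next
    case False
    \<comment> \<open>For negative \<open>m\<close> the path runs from the shifted point up to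
      \<open>(y, w)\<close> and is then reversed.\<close>
    have "(y, w + axis j (2 * pi * \<i> * of_int m)) \<in> M"
    proof -
      have "exp (2 * pi * \<i> * of_int m) = 1" using exp_integer_2pi[of "of_int m"] by (simp add: mult_ac)
      then show ?thesis using yw by (auto simp: log_cover_iff axis_def exp_add)
    qed
    from nat1[OF this, of j "nat (-m)"]
    have "connected_component M (y, w + axis j (2 * pi * \<i> * of_int m))
      (y, w + axis j (2 * pi * \<i> * of_int m) + axis j (2 * pi * \<i> * of_nat (nat (-m))))" .
    moreover have "w + axis j (2 * pi * \<i> * of_int m) + axis j (2 * pi * \<i> * of_nat (nat (-m))) = w"
      using False by (simp add: vec_eq_iff axis_def)
    ultimately have "connected_component M (y, w + axis j (2 * pi * \<i> * of_int m)) (y, w)" by metis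
    then show ?thesis using connected_component_sym by blast
  qed
  have fibre: "connected_component M (y, w) (y, w')" if yw: "(y, w) \<in> M" and yw': "(y, w') \<in> M" for y w w'
  proof -
    have "\<exists>m. w' $ j = w $ j + 2 * pi * \<i> * of_int m" for j
    proof -
      have "exp (w' $ j) = exp (w $ j)" using yw yw' by (simp add: log_cover_iff)
      then obtain m where "w' $ j = w $ j + (of_int (2 * m) * pi) * \<i>" unfolding exp_eq by blast
      then show ?thesis by (intro exI[of _ m]) (simp add: algebra_simps)
    qed
    then obtain m where m: "\<And>j. w' $ j = w $ j + 2 * pi * \<i> * of_int (m j)" by metis
    have "connected_component M (y, w) (y, w + (\<Sum>j\<in>F. axis j (2 * pi * \<i> * of_int (m j))))" if "finite F" for F
      using that
    proof induction
      case empty then show ?case using yw by simp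
    next
      case (insert i F)
      then have "(y, w + (\<Sum>j\<in>F. axis j (2 * pi * \<i> * of_int (m j)))) \<in> M" using connected_component_in by blast
      from int1[OF this, of i "m i"] insert show ?case
        using connected_component_trans by (fastforce simp: algebra_simps)
    qed
    from this[of UNIV] have "connected_component M (y, w) (y, w + (\<Sum>j\<in>UNIV. axis j (2 * pi * \<i> * of_int (m j))))"
      by simp
    moreover have "w + (\<Sum>j\<in>UNIV. axis j (2 * pi * \<i> * of_int (m j))) = w'"
      by (simp add: vec_eq_iff m axis_def)
    ultimately show ?thesis by metis
  qed
  show ?thesis
    unfolding connected_iff_connected_component
  proof (intro ballI)
    fix p q assume p: "p \<in> M" and q: "q \<in> M"
    obtain y w y' w' where pq: "p = (y, w)" "q = (y', w')" by (cases p, cases q)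
    obtain w1 where w1: "connected_component M (y, w) (y', w1)"
      using component_surj[OF Y, of y y' w] p q pq log_cover_iff by metis
    then have "(y', w1) \<in> M" using connected_component_in by blast
    then show "connected_component M p q"
      using fibre[of y' w1 w'] q w1 pq connected_component_trans by blast
  qed
qed

end


section \<open>The lifted five-term relations\<close>

lemma exhaust_5: "x = 1 \<or> x = 2 \<or> x = 3 \<or> x = 4 \<or> x = 5" for x :: 5
proof (induct x)
  case (of_int z)
  then have "z = 0 \<or> z = 1 \<or> z = 2 \<or> z = 3 \<or> z = 4" by fastforce
  then show ?case by auto
qed

lemma forall_5: "(\<forall>i::5. P i) \<longleftrightarrow> P 1 \<and> P 2 \<and> P 3 \<and> P 4 \<and> P 5"
  by (metis exhaust_5)

lemma vector_5 [simp]: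
  "(vector [a, b, c, d, e] :: 'a::zero ^ 5) $ 1 = a"
  "(vector [a, b, c, d, e] :: 'a::zero ^ 5) $ 2 = b"
  "(vector [a, b, c, d, e] :: 'a::zero ^ 5) $ 3 = c"
  "(vector [a, b, c, d, e] :: 'a::zero ^ 5) $ 4 = d"
  "(vector [a, b, c, d, e] :: 'a::zero ^ 5) $ 5 = e"
  by (simp_all add: vector_def)

text \<open>The integers in \<open>hat\<close> move the logarithms of z and 1 - z independently by
  multiples of 2 pi i, so every pair of logarithms occurs. Hence the conditions to be checked later
  are equations between exponentials, free of cuts.\<close>

lemma Chat_iff: "u \<in> Chat \<longleftrightarrow> exp (fst u) + exp (snd u) = 1"
proof
  assume "u \<in> Chat"
  then obtain z s p q where u: "u = hat (z, s) p q" and w: "(z, s) \<in> Cbar_cut" by (auto simp: Chat_def)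
  have "z \<noteq> 0" "z \<noteq> 1" using w by (auto simp: Cbar_cut_def C_cut_def)
  moreover have "exp (2 * pi * \<i> * of_int n) = 1" for n :: int
    using exp_integer_2pi[of "of_int n"] by (simp add: mult_ac)
  moreover have "exp (2 * pi * \<i>) = 1" using exp_two_pi_i by simp
  ultimately show "exp (fst u) + exp (snd u) = 1"
    unfolding u hat_def LogB_def Log1B_def by (auto simp: exp_add exp_diff)
next
  assume *: "exp (fst u) + exp (snd u) = 1"
  define z where "z = exp (fst u)"
  have z: "exp (snd u) = 1 - z" using * by (simp add: z_def algebra_simps)
  then have nz: "z \<noteq> 0" "z \<noteq> 1" by (auto simp: z_def)
  have lift: "\<exists>n. a = b + 2 * pi * \<i> * of_int n" if "exp a = exp b" for a b :: complex
    using that unfolding exp_eq by (metis (no_types, lifting) mult.assoc mult.commute of_int_mult of_int_numeral of_real_mult of_real_numeral of_real_of_int_eq)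
  define w where "w = plus0i z"
  have w: "w \<in> Cbar_cut"
  proof (cases "z \<in> C_cut")
    case False
    then have "Im z = 0" and 1: "Re z \<le> 0 \<or> Re z \<ge> 1" by (auto simp: C_cut_def)
    then have "z = complex_of_real (Re z)" by (simp add: complex_eq_iff)
    moreover from this have "Re z < 0 \<or> Re z > 1" using nz 1 by (metis less_eq_real_def of_real_0 of_real_1)
    ultimately show ?thesis using False by (auto simp: w_def plus0i_def Cbar_cut_def)
  qed (auto simp: w_def plus0i_def Cbar_cut_def)
  have "exp (LogB w) = z" "exp (Log1B w) = 1 - z"
    using nz exp_two_pi_i by (auto simp: w_def plus0i_def LogB_def Log1B_def exp_diff)
  then obtain p q where "fst u = LogB w + 2 * pi * \<i> * of_int p" "snd u = Log1B w + 2 * pi * \<i> * of_int q"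
    using lift[of "fst u" "LogB w"] lift[of "snd u" "Log1B w"] z z_def by auto
  \<comment> \<open>The sign arises because \<open>hat\<close> subtracts 2 pi i q.\<close>
  then have "u = hat w p (- q)" by (simp add: hat_def prod_eq_iff)
  then show "u \<in> Chat" using w unfolding Chat_def by blast
qed

section \<open>The logarithmic cover of the space of pairs (x, y)\<close>

definition FT_base :: "(complex \<times> complex) set" where
  "FT_base = {(x, y). x \<noteq> y \<and> x \<notin> {0, 1} \<and> y \<notin> {0, 1}}"

definition FT_units :: "5 \<Rightarrow> complex \<times> complex \<Rightarrow> complex" where
  "FT_units j p = vector [fst p, 1 - fst p, snd p, 1 - snd p, fst p - snd p] $ j"

definition FT_cover :: "((complex \<times> complex) \<times> (complex ^ 5)) set" where
  "FT_cover = log_cover FT_base FT_units"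

text \<open>The coordinates of \<open>w\<close> are logarithms of \<open>x\<close>, \<open>1 - x\<close>, \<open>y\<close>, \<open>1 - y\<close>, \<open>x - y\<close>.\<close>
definition FT_point :: "complex ^ 5 \<Rightarrow> (complex \<times> complex) ^ 5" where
  "FT_point w = vector
     [(w $ 1, w $ 2), (w $ 3, w $ 4), (w $ 3 - w $ 1, w $ 5 - w $ 1),
      (w $ 3 - w $ 1 + w $ 2 - w $ 4, w $ 5 - w $ 1 - w $ 4), (w $ 2 - w $ 4, w $ 5 - w $ 4)]"

lemma FT_cover_iff: "((x, y), w) \<in> FT_cover \<longleftrightarrow>
    x \<noteq> y \<and> x \<notin> {0, 1} \<and> y \<notin> {0, 1} \<and>
    exp (w $ 1) = x \<and> exp (w $ 2) = 1 - x \<and> exp (w $ 3) = y \<and> exp (w $ 4) = 1 - y \<and> exp (w $ 5) = x - y"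
  by (simp add: FT_cover_def log_cover_iff FT_base_def FT_units_def forall_5)

lemma open_FT_base: "open FT_base"
proof -
  have "FT_base = {p. fst p \<noteq> snd p} \<inter> {p. fst p \<noteq> 0} \<inter> {p. fst p \<noteq> 1} \<inter> {p. snd p \<noteq> 0} \<inter> {p. snd p \<noteq> 1}"
    by (auto simp: FT_base_def)
  moreover have "open \<dots>"
    by (intro open_Int open_Collect_neq continuous_intros)
  ultimately show ?thesis by simp
qed

text \<open>A horizontal or vertical line through a point of the base meets it in a plane with at
  most three punctures. Two points are joined through the horizontal lines at \<open>y\<close> and
  \<open>y'\<close> and a vertical line at some \<open>t\<close> admissible for both.\<close>

lemma connected_FT_base: "connected FT_base"
  unfolding connected_iff_connected_component
proof (intro ballI)
  fix p q assume "p \<in> FT_base" "q \<in> FT_base"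
  then obtain x y x' y' where p: "p = (x, y)" "x \<noteq> y" "x \<notin> {0, 1}" "y \<notin> {0, 1}"
    and q: "q = (x', y')" "x' \<noteq> y'" "x' \<notin> {0, 1}" "y' \<notin> {0, 1}"
    by (auto simp: FT_base_def)
  have c: "connected (UNIV - {0, 1, z})" for z :: complex
    by (intro connected_open_delete_finite) auto
  have h: "connected_component FT_base (a, b) (a', b)"
    if "a \<notin> {0, 1, b}" "a' \<notin> {0, 1, b}" "b \<notin> {0, 1}" for a a' b
  proof (rule connected_componentI)
    show "connected ((\<lambda>t. (t, b)) ` (UNIV - {0, 1, b}))"
      by (intro connected_continuous_image continuous_intros c)
  qed (use that in \<open>auto simp: FT_base_def\<close>)
  have v: "connected_component FT_base (a, b) (a, b')"
    if "b \<notin> {0, 1, a}" "b' \<notin> {0, 1, a}" "a \<notin> {0, 1}" for a b b'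
  proof (rule connected_componentI)
    show "connected ((\<lambda>t. (a, t)) ` (UNIV - {0, 1, a}))"
      by (intro connected_continuous_image continuous_intros c)
  qed (use that in \<open>auto simp: FT_base_def\<close>)
  obtain t :: complex where t: "t \<notin> {0, 1, y, y'}"
    using ex_new_if_finite[of "{0, 1, y, y'}"] by (auto simp: infinite_UNIV_char_0)
  have "connected_component FT_base (x, y) (t, y)" using p t by (intro h) auto
  moreover have "connected_component FT_base (t, y) (t, y')" using p q t by (intro v) auto
  moreover have "connected_component FT_base (t, y') (x', y')" using q t by (intro h) auto
  ultimately show "connected_component FT_base p q"
    unfolding p(1) q(1) using connected_component_trans by meson
qed

interpretation FT: log_cover_base FT_base FT_units
proof
  show "open FT_base" by (rule open_FT_base)
  show "continuous_on FT_base (FT_units j)" for j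
    unfolding FT_units_def using exhaust_5[of j] by (elim disjE; simp only: vector_5; intro continuous_intros)
  show "FT_units j y \<noteq> 0" if "y \<in> FT_base" for j y
    using exhaust_5[of j] that by (auto simp: FT_units_def FT_base_def)
qed

lemma FT_loop:
  fixes x y :: "real \<Rightarrow> complex" and L :: "real \<Rightarrow> complex ^ 5"
  assumes "\<And>t. ((x t, y t), L t) \<in> FT_cover"
    and "continuous_on UNIV x" "continuous_on UNIV y"
    and "\<And>i. continuous_on UNIV (\<lambda>t. L t $ i)"
    and "x (2 * pi) = x 0" "y (2 * pi) = y 0" "L (2 * pi) = L 0 + axis j (2 * pi * \<i>)"
  shows "\<exists>y w. connected_component FT_cover (y, w) (y, w + axis j (2 * pi * \<i>))"
proof -
  let ?g = "\<lambda>t. ((x t, y t), L t)"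
  have "continuous_on UNIV L"
    using continuous_on_vec_lambda[of UNIV "\<lambda>i t. L t $ i"] assms(4) by simp
  then have "connected (range ?g)"
    using assms by (intro connected_continuous_image continuous_intros) auto
  then have "connected_component FT_cover (?g 0) (?g (2 * pi))"
    by (rule connected_componentI) (use assms(1) in \<open>auto intro!: rangeI\<close>)
  then show ?thesis using assms by auto
qed

text \<open>The unit in question runs once around a circle about 0, of radius 1/2 for the first four
  and 1/4 for x - y. The fixed values 5, -5 and 1/2 make every other unit either constant or of
  positive real part, so that its principal logarithm is continuous and closes up.\<close>

lemma FT_loops: "\<exists>y w. connected_component FT_cover (y, w) (y, w + axis j (2 * pi * \<i>))"
proof -
  define c where "c = (\<lambda>t. exp (\<i> * complex_of_real t))"
  have c: "continuous_on UNIV c" unfolding c_def by (intro continuous_intros)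
  have c0: "c 0 = 1" "c (2 * pi) = 1" by (simp_all add: c_def exp_two_pi_i' mult_ac)
  have nz: "c t \<noteq> 0" for t by (simp add: c_def)
  have re: "-1 \<le> Re (c t)" "Re (c t) \<le> 1" for t by (simp_all add: c_def Re_exp)
  have half: "exp (\<i> * complex_of_real t + Ln (1 / 2)) = c t / 2" "exp (\<i> * complex_of_real t + Ln (1 / 4)) = c t / 4" for t
    by (simp_all add: exp_add c_def)
  have slit: "z \<notin> \<real>\<^sub>\<le>\<^sub>0" "z \<noteq> 0" if "Re z > 0" for z using that by (auto simp: complex_nonpos_Reals_iff)
  have pos: "Re (1 - c t / 2) > 0" "Re (5 + c t / 2) > 0" "Re (6 - c t / 2) > 0" "Re (5 - c t / 2) > 0" "Re (4 + c t / 2) > 0"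
      "Re (1 / 2 + c t / 4) > 0" "Re (1 / 2 - c t / 4) > 0" for t
    using re[of t] by auto
  have ne: "1 - c t / 2 \<noteq> 0" "5 + c t / 2 \<noteq> 0" "6 - c t / 2 \<noteq> 0" "5 - c t / 2 \<noteq> 0" "4 + c t / 2 \<noteq> 0"
      "1 / 2 + c t / 4 \<noteq> 0" "1 / 2 - c t / 4 \<noteq> 0" "c t / 2 \<noteq> 1" "- (c t / 2) \<noteq> 4" for t
    using pos[THEN slit(2), of t] by (simp_all add: eq_neg_iff_add_eq_0 neg_eq_iff_add_eq_0 add.commute)
  have ne': "1 / 2 + c t / 4 \<noteq> 1" for t
    using re[of t] by (auto simp: complex_eq_iff)
  have "j = 1 \<or> j = 2 \<or> j = 3 \<or> j = 4 \<or> j = 5" by (rule exhaust_5)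
  then show ?thesis
  proof (elim disjE)
    assume j: "j = 1"
    show ?thesis
      apply (rule FT_loop[where x = "\<lambda>t. c t / 2" and y = "\<lambda>t. -5" and
        L = "\<lambda>t. vector [Ln (1 / 2) + \<i> * t, Ln (1 - c t / 2), Ln (-5), Ln 6, Ln (5 + c t / 2)]"])
      subgoal for t using nz[of t] pos[of t] ne[of t] ne'[of t] by (auto simp: FT_cover_iff half add.commute)
      subgoal by (auto intro!: continuous_intros c)
      subgoal by (intro continuous_intros)
      subgoal for i using exhaust_5[of i]
        by (elim disjE; simp only: vector_5) (auto intro!: continuous_intros c slit pos)
      subgoal by (simp add: c0)
      subgoal by simp
      subgoal by (simp add: j c0 vec_eq_iff forall_5 axis_def)
      done
  next
    assume j: "j = 2"
    show ?thesis
      apply (rule FT_loop[where x = "\<lambda>t. 1 - c t / 2" and y = "\<lambda>t. -5" and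
        L = "\<lambda>t. vector [Ln (1 - c t / 2), Ln (1 / 2) + \<i> * t, Ln (-5), Ln 6, Ln (6 - c t / 2)]"])
      subgoal for t using nz[of t] pos[of t] ne[of t] ne'[of t] by (auto simp: FT_cover_iff half add.commute)
      subgoal by (auto intro!: continuous_intros c)
      subgoal by (intro continuous_intros)
      subgoal for i using exhaust_5[of i]
        by (elim disjE; simp only: vector_5) (auto intro!: continuous_intros c slit pos)
      subgoal by (simp add: c0)
      subgoal by simp
      subgoal by (simp add: j c0 vec_eq_iff forall_5 axis_def)
      done
  next
    assume j: "j = 3"
    show ?thesis
      apply (rule FT_loop[where x = "\<lambda>t. 5" and y = "\<lambda>t. c t / 2" and
        L = "\<lambda>t. vector [Ln 5, Ln (-4), Ln (1 / 2) + \<i> * t, Ln (1 - c t / 2), Ln (5 - c t / 2)]"])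
      subgoal for t using nz[of t] pos[of t] ne[of t] ne'[of t] by (auto simp: FT_cover_iff half add.commute)
      subgoal by (intro continuous_intros)
      subgoal by (auto intro!: continuous_intros c)
      subgoal for i using exhaust_5[of i]
        by (elim disjE; simp only: vector_5) (auto intro!: continuous_intros c slit pos)
      subgoal by simp
      subgoal by (simp add: c0)
      subgoal by (simp add: j c0 vec_eq_iff forall_5 axis_def)
      done
  next
    assume j: "j = 4"
    show ?thesis
      apply (rule FT_loop[where x = "\<lambda>t. 5" and y = "\<lambda>t. 1 - c t / 2" and
        L = "\<lambda>t. vector [Ln 5, Ln (-4), Ln (1 - c t / 2), Ln (1 / 2) + \<i> * t, Ln (4 + c t / 2)]"])
      subgoal for t using nz[of t] pos[of t] ne[of t] ne'[of t] by (auto simp: FT_cover_iff half add.commute)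
      subgoal by (intro continuous_intros)
      subgoal by (auto intro!: continuous_intros c)
      subgoal for i using exhaust_5[of i]
        by (elim disjE; simp only: vector_5) (auto intro!: continuous_intros c slit pos)
      subgoal by simp
      subgoal by (simp add: c0)
      subgoal by (simp add: j c0 vec_eq_iff forall_5 axis_def)
      done
  next
    assume j: "j = 5"
    show ?thesis
      apply (rule FT_loop[where x = "\<lambda>t. 1 / 2 + c t / 4" and y = "\<lambda>t. 1 / 2" and
        L = "\<lambda>t. vector [Ln (1 / 2 + c t / 4), Ln (1 / 2 - c t / 4), Ln (1 / 2), Ln (1 / 2), Ln (1 / 4) + \<i> * t]"])
      subgoal for t using nz[of t] pos[of t] ne[of t] ne'[of t] by (auto simp: FT_cover_iff half add.commute)
      subgoal by (auto intro!: continuous_intros c)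
      subgoal by (intro continuous_intros)
      subgoal for i using exhaust_5[of i]
        by (elim disjE; simp only: vector_5) (auto intro!: continuous_intros c slit pos)
      subgoal by (simp add: c0)
      subgoal by simp
      subgoal by (simp add: j c0 vec_eq_iff forall_5 axis_def)
      done
  qed
qed

lemma connected_FT_cover: "connected FT_cover"
  using FT.connected_log_cover[OF connected_FT_base] FT_loops unfolding FT_cover_def by blast

section \<open>The component of the lifted relations\<close>

lemma eq_0_of_connected_exp_eq_1:
  fixes f :: "'b::topological_space \<Rightarrow> complex"
  assumes "connected S" "continuous_on S f" "\<And>x. x \<in> S \<Longrightarrow> exp (f x) = 1" "a \<in> S" "f a = 0" "b \<in> S"
  shows "f b = 0"
proof -
  \<comment> \<open>The values lie in the discrete set 2 pi i Z. In this way a relation between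
    logarithms known at one point spreads over a connected set.\<close>
  have "f constant_on S"
  proof (rule continuous_discrete_range_constant[OF assms(1,2)])
    fix x assume x: "x \<in> S"
    have "1 \<le> norm (f y - f x)" if "y \<in> S" "f y \<noteq> f x" for y
    proof (rule ccontr)
      assume "\<not> 1 \<le> norm (f y - f x)"
      then have "\<bar>Im (f y) - Im (f x)\<bar> < 1" using abs_Im_le_cmod[of "f y - f x"] by simp
      then have "\<bar>Im (f y) - Im (f x)\<bar> < 2 * pi" using pi_gt3 by linarith
      then show False using exp_complex_eqI[of "f y" "f x"] that assms(3) x by simp
    qed
    then show "\<exists>e>0. \<forall>y. y \<in> S \<and> f y \<noteq> f x \<longrightarrow> e \<le> norm (f y - f x)"
      by (intro exI[of _ 1]) auto
  qed
  then show ?thesis using assms by (auto simp: constant_on_def)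
qed

lemma FT_cross_ratios:
  fixes x y :: complex
  assumes "x \<noteq> 0" "x \<noteq> 1" "y \<noteq> 0" "y \<noteq> 1"
  shows "(1 - 1 / x) / (1 - 1 / y) = y / x * ((1 - x) / (1 - y))"
    and "1 - (1 - 1 / x) / (1 - 1 / y) = (1 - y / x) / (1 - y)"
    and "1 - (1 - x) / (1 - y) = x * ((1 - y / x) / (1 - y))"
proof -
  have "1 - 1 / x = - ((1 - x) / x)" "1 - 1 / y = - ((1 - y) / y)" using assms by (simp_all add: diff_divide_distrib)
  then show 1: "(1 - 1 / x) / (1 - 1 / y) = y / x * ((1 - x) / (1 - y))" using assms by simp
  have "1 - y \<noteq> 0" using assms by simp
  then show "1 - (1 - 1 / x) / (1 - 1 / y) = (1 - y / x) / (1 - y)" "1 - (1 - x) / (1 - y) = x * ((1 - y / x) / (1 - y))"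
    unfolding 1 using assms(1) by (simp_all add: divide_simps, simp_all add: algebra_simps)
qed

lemma FT_point_in_FT_lift:
  assumes "(p, w) \<in> FT_cover"
  shows "FT_point w \<in> FT_lift"
proof -
  obtain x y where p: "p = (x, y)" by (cases p)
  then have xy: "x \<noteq> y" "x \<noteq> 0" "x \<noteq> 1" "y \<noteq> 0" "y \<noteq> 1" and
    w: "exp (w $ 1) = x" "exp (w $ 2) = 1 - x" "exp (w $ 3) = y" "exp (w $ 4) = 1 - y" "exp (w $ 5) = x - y"
    using assms FT_cover_iff by auto
  have s3: "y / x + (x - y) / x = 1" and s5: "(1 - x) / (1 - y) + (x - y) / (1 - y) = 1"
    using xy by (simp_all flip: add_divide_distrib)
  have s4: "y / x * (1 - x) / (1 - y) + (x - y) / x / (1 - y) = 1"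
  proof -
    define t where "t = 1 - y"
    then have "t \<noteq> 0" and y: "y = 1 - t" using xy by (simp_all add: t_def)
    then show ?thesis unfolding t_def[symmetric] using xy(2) by (simp add: y) (simp add: field_simps)
  qed
  have "exp (fst (FT_point w $ i)) + exp (snd (FT_point w $ i)) = 1" for i
    using exhaust_5[of i] s3 s4 s5
    by (elim disjE; simp only: FT_point_def vector_5 fst_conv snd_conv exp_diff exp_add w; simp)
  then have "FT_point w $ i \<in> Chat" for i by (simp only: Chat_iff)
  moreover have "(\<chi> i. pihat (FT_point w $ i)) = vector [x, y, y / x, (1 - 1 / x) / (1 - 1 / y), (1 - x) / (1 - y)]"
    by (simp add: vec_eq_iff forall_5 FT_point_def pihat_def exp_diff exp_add w FT_cross_ratios(1)[OF xy(2-5)])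
  ultimately show ?thesis using xy by (auto simp: FT_lift_def FT_def)
qed

text \<open>On all of \<open>FT_lift\<close> the relations between the logarithms hold only after
  exponentiation; on the distinguished component they will lift to linear ones.\<close>

lemma FT_lift_exp:
  assumes "u \<in> FT_lift"
  shows "exp (fst (u $ 3)) = exp (fst (u $ 2)) / exp (fst (u $ 1))"
    and "exp (fst (u $ 4)) = exp (fst (u $ 3)) * exp (fst (u $ 5))"
    and "exp (fst (u $ 5)) = exp (snd (u $ 1)) / exp (snd (u $ 2))"
    and "exp (snd (u $ 4)) = exp (snd (u $ 3)) / exp (snd (u $ 2))"
    and "exp (snd (u $ 5)) = exp (snd (u $ 4)) * exp (fst (u $ 1))"
    and "exp (fst (u $ 1)) + exp (snd (u $ 1)) = 1" "exp (fst (u $ 2)) + exp (snd (u $ 2)) = 1"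
    and "exp (snd (u $ 3)) * exp (fst (u $ 1)) = exp (fst (u $ 1)) - exp (fst (u $ 2))"
    and "exp (fst (u $ 1)) \<noteq> exp (fst (u $ 2))" "exp (fst (u $ 1)) \<noteq> 1" "exp (fst (u $ 2)) \<noteq> 1"
proof -
  have v: "exp (snd (u $ i)) = 1 - exp (fst (u $ i))" for i
    using assms by (auto simp: FT_lift_def Chat_iff algebra_simps)
  obtain x y where xy: "x \<noteq> y" "x \<noteq> 0" "x \<noteq> 1" "y \<noteq> 0" "y \<noteq> 1"
    and u: "exp (fst (u $ 1)) = x" "exp (fst (u $ 2)) = y" "exp (fst (u $ 3)) = y / x"
       "exp (fst (u $ 4)) = (1 - 1 / x) / (1 - 1 / y)" "exp (fst (u $ 5)) = (1 - x) / (1 - y)"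
    using assms unfolding FT_lift_def FT_def vec_eq_iff forall_5 pihat_def by auto
  note c1 = FT_cross_ratios(1)[OF xy(2-5)]
  note cr = c1 FT_cross_ratios(2)[OF xy(2-5), unfolded c1] FT_cross_ratios(3)[OF xy(2-5)]
  show "exp (fst (u $ 3)) = exp (fst (u $ 2)) / exp (fst (u $ 1))" "exp (fst (u $ 4)) = exp (fst (u $ 3)) * exp (fst (u $ 5))"
    "exp (fst (u $ 5)) = exp (snd (u $ 1)) / exp (snd (u $ 2))" "exp (snd (u $ 4)) = exp (snd (u $ 3)) / exp (snd (u $ 2))"
    "exp (snd (u $ 5)) = exp (snd (u $ 4)) * exp (fst (u $ 1))"
    "exp (fst (u $ 1)) + exp (snd (u $ 1)) = 1" "exp (fst (u $ 2)) + exp (snd (u $ 2)) = 1"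
    "exp (fst (u $ 1)) \<noteq> exp (fst (u $ 2))" "exp (fst (u $ 1)) \<noteq> 1" "exp (fst (u $ 2)) \<noteq> 1"
    using xy unfolding v u cr by simp_all
  show "exp (snd (u $ 3)) * exp (fst (u $ 1)) = exp (fst (u $ 1)) - exp (fst (u $ 2))"
    using xy unfolding v u by (simp add: field_simps)
qed

text \<open>For t in the upper half plane, Ln t has imaginary part in (0, pi) and Ln (1 - t) in
  (-pi, 0). Therefore the two sides of each linear relation differ in imaginary part by less than 2
  pi and agree as soon as their exponentials do.\<close>

lemma principal_FT_point:
  assumes "v \<in> FT_plus"
  obtains p w where "(p, w) \<in> FT_cover" "FT_point w = (\<chi> i. hat (v $ i, 0) 0 0)"
proof -
  obtain x y where v: "v = vector [x, y, y / x, (1 - 1 / x) / (1 - 1 / y), (1 - x) / (1 - y)]"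
    and xy: "x \<noteq> y" "x \<noteq> 0" "x \<noteq> 1" "y \<noteq> 0" "y \<noteq> 1"
    using assms by (auto simp: FT_plus_def FT_def)
  have im: "Im (v $ i) > 0" for i using assms by (auto simp: FT_plus_def)
  define z where "z = y / x"
  define z' where "z' = (1 - 1 / x) / (1 - 1 / y)"
  define z'' where "z'' = (1 - x) / (1 - y)"
  have ims: "Im x > 0" "Im y > 0" "Im z > 0" "Im z' > 0" "Im z'' > 0"
    using im[of 1] im[of 2] im[of 3] im[of 4] im[of 5] by (simp_all add: v z_def z'_def z''_def)
  have A: "0 < Im (Ln t) \<and> Im (Ln t) < pi" if "Im t > 0" for t
    using that Im_Ln_pos_lt_imp by blast
  have B: "- pi < Im (Ln (1 - t)) \<and> Im (Ln (1 - t)) < 0" if "Im t > 0" for t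
    using that mpi_less_Im_Ln[of "1 - t"] Im_Ln_pos_le[of "1 - t"] Im_Ln_le_pi[of "1 - t"]
    by (auto simp: complex_eq_iff)
  have ne: "1 - z \<noteq> 0" "z \<noteq> 0" "1 - z' \<noteq> 0" "z' \<noteq> 0" "1 - z'' \<noteq> 0" "z'' \<noteq> 0" using ims by (auto simp: complex_eq_iff)
  have zz: "z = y / x" "z' = z * z''" "1 - z' = (1 - z) / (1 - y)" "1 - z'' = x * (1 - z) / (1 - y)"
    using FT_cross_ratios[OF xy(2-5)] by (simp_all add: z_def z'_def z''_def)
  note B' = B[OF ims(1)] B[OF ims(2)] B[OF ims(3)] B[OF ims(4)] B[OF ims(5)]
  note A' = A[OF ims(1)] A[OF ims(2)] A[OF ims(3)] A[OF ims(4)] A[OF ims(5)]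
  have l1: "Ln z = Ln y - Ln x"
  proof (rule exp_complex_eqI)
    show "\<bar>Im (Ln z) - Im (Ln y - Ln x)\<bar> < 2 * pi"
      using A' B' unfolding minus_complex.sel plus_complex.sel by linarith
    show "exp (Ln z) = exp (Ln y - Ln x)"
      using xy ne by (simp add: exp_add exp_diff z_def)
  qed
  have l2: "Ln z'' = Ln (1 - x) - Ln (1 - y)"
  proof (rule exp_complex_eqI)
    show "\<bar>Im (Ln z'') - Im (Ln (1 - x) - Ln (1 - y))\<bar> < 2 * pi"
      using A' B' unfolding minus_complex.sel plus_complex.sel by linarith
    show "exp (Ln z'') = exp (Ln (1 - x) - Ln (1 - y))"
      using xy ne by (simp add: exp_add exp_diff z''_def)
  qed
  have l3: "Ln z' = Ln z + Ln z''"
  proof (rule exp_complex_eqI)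
    show "\<bar>Im (Ln z') - Im (Ln z + Ln z'')\<bar> < 2 * pi"
      using A' B' unfolding minus_complex.sel plus_complex.sel by linarith
    show "exp (Ln z') = exp (Ln z + Ln z'')"
      using xy ne by (simp add: exp_add exp_diff zz(2))
  qed
  have l4: "Ln (1 - z') = Ln (1 - z) - Ln (1 - y)"
  proof (rule exp_complex_eqI)
    show "\<bar>Im (Ln (1 - z')) - Im (Ln (1 - z) - Ln (1 - y))\<bar> < 2 * pi"
      using A' B' unfolding minus_complex.sel plus_complex.sel by linarith
    show "exp (Ln (1 - z')) = exp (Ln (1 - z) - Ln (1 - y))"
      using xy ne by (simp add: exp_add exp_diff zz(3))
  qed
  \<comment> \<open>Bounding the three terms on the right separately would be too weak; by
    \<open>l4\<close> the first two combine to Ln (1 - z'), with imaginary part in (-pi, 0).\<close>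
  have l5: "Ln (1 - z'') = Ln (1 - z) - Ln (1 - y) + Ln x"
  proof (rule exp_complex_eqI)
    show "\<bar>Im (Ln (1 - z'')) - Im (Ln (1 - z) - Ln (1 - y) + Ln x)\<bar> < 2 * pi"
      using A' B' arg_cong[OF l4, of Im] unfolding minus_complex.sel plus_complex.sel by linarith
    show "exp (Ln (1 - z'')) = exp (Ln (1 - z) - Ln (1 - y) + Ln x)"
      using xy ne by (simp add: exp_add exp_diff zz(4))
  qed
  \<comment> \<open>The last coordinate is a logarithm of x - y = (1 - z) x.\<close>
  define w :: "complex ^ 5" where "w = vector [Ln x, Ln (1 - x), Ln y, Ln (1 - y), Ln (1 - z) + Ln x]"
  show thesis
  proof
    show "((x, y), w) \<in> FT_cover"
      using xy ne by (auto simp: FT_cover_iff w_def exp_add z_def field_simps)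
    show "FT_point w = (\<chi> i. hat (v $ i, 0) 0 0)"
      unfolding v z_def[symmetric] z'_def[symmetric] z''_def[symmetric]
      by (simp add: vec_eq_iff forall_5 FT_point_def w_def hat_def LogB_def Log1B_def l1 l2 l3 l4 l5)
  qed
qed

lemma FT_plus_nonempty: "FT_plus \<noteq> {}"
proof -
  \<comment> \<open>The third and fifth entries become 3 + i and (5 + i)/13, and the fourth is their
    product (14 + 8i)/13.\<close>
  let ?x = "\<i>" and ?y = "Complex (-1) 3"
  have xy: "?x \<noteq> ?y" "?x \<noteq> 0" "?x \<noteq> 1" "?y \<noteq> 0" "?y \<noteq> 1" by (simp_all add: complex_eq_iff)
  have z: "?y / ?x = Complex 3 1" "(1 - ?x) / (1 - ?y) = Complex (5 / 13) (1 / 13)"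
    using xy by (intro nonzero_divide_eq_eq[THEN iffD2]; simp add: complex_eq_iff)+
  have "vector [?x, ?y, ?y / ?x, (1 - 1 / ?x) / (1 - 1 / ?y), (1 - ?x) / (1 - ?y)] \<in> FT_plus"
    unfolding FT_plus_def mem_Collect_eq
  proof
    show "vector [?x, ?y, ?y / ?x, (1 - 1 / ?x) / (1 - 1 / ?y), (1 - ?x) / (1 - ?y)] \<in> FT"
      unfolding FT_def using xy by blast
  qed (simp only: forall_5 vector_5 FT_cross_ratios(1)[OF xy(2-5)] z, simp)
  then show ?thesis by blast
qed

text \<open>The image of the connected cover contains every principal point, hence lies in the
  component. Conversely, each of the five relations is a continuous function with exponential 1 on
  \<open>FT_lift\<close> that vanishes at a principal point, hence vanishes on the component;
  together they express all ten logarithms by five.\<close>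

lemma FT_hat_eq: "FT_hat = FT_point ` snd ` FT_cover"
proof
  let ?P = "\<lambda>v. (\<chi> i. hat (v $ i, 0) 0 0) :: (complex \<times> complex) ^ 5"
  have "continuous_on UNIV FT_point"
  proof -
    have "continuous_on UNIV (\<lambda>w. FT_point w $ i)" for i
      unfolding FT_point_def using exhaust_5[of i] by (elim disjE; simp only: vector_5; intro continuous_intros)
    then show ?thesis using continuous_on_vec_lambda[of UNIV "\<lambda>i w. FT_point w $ i"] by simp
  qed
  then have conn: "connected (FT_point ` snd ` FT_cover)"
    by (intro connected_continuous_image connected_FT_cover continuous_intros) (auto intro: continuous_on_subset)
  obtain v where v: "v \<in> FT_plus" using FT_plus_nonempty by blast
  then have "?P v \<in> FT_point ` snd ` FT_cover" using principal_FT_point by (metis image_eqI snd_conv)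
  then have "FT_point ` snd ` FT_cover \<subseteq> connected_component_set FT_lift (?P v)"
    using conn FT_point_in_FT_lift by (intro connected_component_maximal) auto
  then show "FT_point ` snd ` FT_cover \<subseteq> FT_hat"
    using v by (auto simp: FT_hat_def)
  show "FT_hat \<subseteq> FT_point ` snd ` FT_cover"
  proof
    fix w assume "w \<in> FT_hat"
    then obtain v where v: "v \<in> FT_plus" and w: "w \<in> connected_component_set FT_lift (?P v)"
      by (auto simp: FT_hat_def)
    let ?C = "connected_component_set FT_lift (?P v)"
    have C: "?C \<subseteq> FT_lift" by (rule connected_component_subset)
    have start: "?P v \<in> ?C" using w by (metis connected_component_eq_empty connected_component_refl_eq empty_iff mem_Collect_eq)
    obtain p w0 where w0: "(p, w0) \<in> FT_cover" "FT_point w0 = ?P v" using principal_FT_point[OF v] by blast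
    have zero: "l w = 0" if l: "continuous_on UNIV l" "\<And>u. u \<in> FT_lift \<Longrightarrow> exp (l u) = 1" "l (FT_point w0) = 0" for l :: "_ \<Rightarrow> complex"
      by (rule eq_0_of_connected_exp_eq_1[of ?C l "?P v"])
        (use l C start w w0 in \<open>auto intro: continuous_on_subset\<close>)
    have "fst (w $ 3) - (fst (w $ 2) - fst (w $ 1)) = 0"
      by (rule zero) (auto intro!: continuous_intros simp: FT_point_def exp_diff FT_lift_exp)
    moreover have "fst (w $ 4) - fst (w $ 3) - fst (w $ 5) = 0"
      by (rule zero) (auto intro!: continuous_intros simp: FT_point_def exp_diff FT_lift_exp)
    moreover have "fst (w $ 5) - (snd (w $ 1) - snd (w $ 2)) = 0"
      by (rule zero) (auto intro!: continuous_intros simp: FT_point_def exp_diff FT_lift_exp)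
    moreover have "snd (w $ 4) - (snd (w $ 3) - snd (w $ 2)) = 0"
      by (rule zero) (auto intro!: continuous_intros simp: FT_point_def exp_diff FT_lift_exp)
    moreover have "snd (w $ 5) - snd (w $ 4) - fst (w $ 1) = 0"
      by (rule zero) (auto intro!: continuous_intros simp: FT_point_def exp_diff FT_lift_exp)
    \<comment> \<open>Since 1 - y/x = (x - y)/x, a logarithm of x - y is recovered by adding the
      logarithm of x to the second coordinate of the third entry.\<close>
    ultimately have w_eq: "w = FT_point (vector [fst (w $ 1), snd (w $ 1), fst (w $ 2), snd (w $ 2), snd (w $ 3) + fst (w $ 1)])"
      by (simp add: vec_eq_iff forall_5 FT_point_def prod_eq_iff algebra_simps)
    have "w \<in> FT_lift" using w C by blast
    from FT_lift_exp[OF this] this have "((exp (fst (w $ 1)), exp (fst (w $ 2))), vector [fst (w $ 1), snd (w $ 1), fst (w $ 2), snd (w $ 2), snd (w $ 3) + fst (w $ 1)]) \<in> FT_cover"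
      by (auto simp: FT_cover_iff exp_add Chat_iff algebra_simps)
    then show "w \<in> FT_point ` snd ` FT_cover" using w_eq by (metis image_eqI snd_conv)
  qed
qed


section \<open>The exponentiated Rogers dilogarithm\<close>

text \<open>The widest symmetric strip free of poles of \<open>dilog_integrand\<close>, the nearest
  ones being at 2 pi i and -2 pi i.\<close>

definition dilog_strip :: "complex set" where
  "dilog_strip = {v. \<bar>Im v\<bar> < 2 * pi}"

text \<open>Since \<open>d Li\<^sub>2 (z) = - v du\<close> with \<open>u = log (1 - exp v)\<close>, this is the derivative of
  \<open>Li\<^sub>2 (1 - exp v)\<close> with respect to \<open>v\<close>. Its poles \<open>2 \<pi> \<i> k\<close>, \<open>k \<noteq> 0\<close>, have residues in
  \<open>2 \<pi> \<i> \<int>\<close>, so that only the exponential of the primitive extends beyond the strip.\<close>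
definition dilog_integrand :: "complex \<Rightarrow> complex" where
  "dilog_integrand v = (if v = 0 then -1 else v / (exp (- v) - 1))"

lemma dilog_strip: "open dilog_strip" "convex dilog_strip" "0 \<in> dilog_strip"
proof -
  have eq: "dilog_strip = {v. Im v < 2 * pi} \<inter> {v. Im v > - 2 * pi}" by (auto simp: dilog_strip_def)
  show "open dilog_strip" unfolding eq by (intro open_Int open_halfspace_Im_lt open_halfspace_Im_gt)
  show "convex dilog_strip" unfolding eq by (intro convex_Int convex_halfspace_Im_lt convex_halfspace_Im_gt)
qed (simp add: dilog_strip_def)

lemma exp_eq_1_strip:
  assumes "v \<in> dilog_strip" "exp v = 1"
  shows "v = 0"
  using exp_complex_eqI[of v 0] assms by (simp add: dilog_strip_def)

text \<open>The singularity at 0 is removable. Continuity there is enough, because the primitive on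
  a convex set may be formed with a finite exceptional set of points of mere continuity.\<close>

lemma dilog_primitive_exists:
  "\<exists>G. \<forall>v \<in> dilog_strip. (G has_field_derivative dilog_integrand v) (at v)"
proof -
  have diff: "dilog_integrand field_differentiable at v" if "v \<in> dilog_strip" "v \<noteq> 0" for v
  proof -
    have "exp (- v) \<noteq> 1" using exp_eq_1_strip[of "- v"] that by (auto simp: dilog_strip_def)
    then have d: "((\<lambda>v. v / (exp (- v) - 1)) has_field_derivative
        (1 * (exp (- v) - 1) - v * (exp (- v) * - 1 - 0)) / ((exp (- v) - 1) * (exp (- v) - 1))) (at v)"
      by (intro DERIV_divide DERIV_diff DERIV_ident DERIV_const DERIV_chain2[OF DERIV_exp] DERIV_minus) auto
    have ev: "\<forall>\<^sub>F u in nhds v. dilog_integrand u = u / (exp (- u) - 1)"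
      using t1_space_nhds[OF \<open>v \<noteq> 0\<close>] by eventually_elim (simp add: dilog_integrand_def)
    show ?thesis
      using DERIV_cong_ev[OF refl ev refl, THEN iffD2, OF d] unfolding field_differentiable_def by blast
  qed
  have "isCont dilog_integrand 0"
  proof -
    have "((\<lambda>v. exp (- v)) has_field_derivative - 1) (at (0 :: complex))"
      by (auto intro!: derivative_eq_intros)
    then have "((\<lambda>v. (exp (- v) - 1) / v) \<longlongrightarrow> - 1) (at (0 :: complex))"
      by (simp add: has_field_derivative_iff)
    then have "((\<lambda>v. inverse ((exp (- v) - 1) / v)) \<longlongrightarrow> inverse (- 1)) (at (0 :: complex))"
      by (intro tendsto_inverse) auto
    then have "((\<lambda>v. v / (exp (- v) - 1)) \<longlongrightarrow> - 1) (at (0 :: complex))" by simp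
    moreover have "\<forall>\<^sub>F u in at 0. u / (exp (- u) - 1) = dilog_integrand u"
      by (auto simp: eventually_at_filter dilog_integrand_def)
    ultimately have "(dilog_integrand \<longlongrightarrow> - 1) (at 0)" by (rule Lim_transform_eventually)
    then show ?thesis by (simp add: isCont_def dilog_integrand_def)
  qed
  then have "isCont dilog_integrand v" if "v \<in> dilog_strip" for v
    using diff[OF that] by (cases "v = 0") (auto intro: field_differentiable_imp_continuous_at)
  then have "continuous_on dilog_strip dilog_integrand" by (simp add: continuous_at_imp_continuous_on)
  then obtain G where "\<And>v. v \<in> dilog_strip \<Longrightarrow> (G has_field_derivative dilog_integrand v) (at v within dilog_strip)"
    using holomorphic_convex_primitive[OF dilog_strip(2), of "{0}" dilog_integrand] diff
    by (auto simp: interior_open dilog_strip)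
  then show ?thesis using at_within_open[OF _ dilog_strip(1)] by metis
qed

text \<open>Chosen without normalisation: another additive constant multiplies
  \<open>expdilog\<close> by a nonzero factor, which cancels in \<open>expdilog_shift\<close> and is
  absorbed by the constant of \<open>rogers_five_constant\<close>.\<close>

definition dilog_primitive :: "complex \<Rightarrow> complex" where
  "dilog_primitive = (SOME G. \<forall>v \<in> dilog_strip. (G has_field_derivative dilog_integrand v) (at v))"

lemma DERIV_dilog_primitive:
  "v \<in> dilog_strip \<Longrightarrow> (dilog_primitive has_field_derivative dilog_integrand v) (at v)"
  using someI_ex[OF dilog_primitive_exists] unfolding dilog_primitive_def by blast

definition expdilog :: "complex \<Rightarrow> complex" where
  "expdilog v = exp (dilog_primitive v / (2 * pi * \<i>))"

text \<open>The constant of integration vanishes because both sides have the same limit as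
  \<open>Re v \<rightarrow> -\<infinity>\<close>, where the integrand decays exponentially.\<close>
lemma expdilog_shift:
  assumes "- 2 * pi < Im v" "Im v < 0"
  shows "expdilog (v + 2 * pi * \<i>) * (1 - exp v) = expdilog v"
proof -
  define T where "T = {v. - 2 * pi < Im v \<and> Im v < 0}"
  have T: "convex T"
  proof -
    have "T = {v. Im v < 0} \<inter> {v. Im v > - 2 * pi}" by (auto simp: T_def)
    then show ?thesis by (auto intro!: convex_Int convex_halfspace_Im_lt convex_halfspace_Im_gt)
  qed
  have strip: "v \<in> dilog_strip" "v + 2 * pi * \<i> \<in> dilog_strip" "exp v \<noteq> 1" "exp (- v) \<noteq> 1" "v \<noteq> 0" "v + 2 * pi * \<i> \<noteq> 0"
    if "v \<in> T" for v
  proof -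
    show 1: "v \<in> dilog_strip" "v + 2 * pi * \<i> \<in> dilog_strip" using that by (auto simp: T_def dilog_strip_def)
    show 2: "v \<noteq> 0" "v + 2 * pi * \<i> \<noteq> 0" using that by (auto simp: T_def complex_eq_iff)
    show "exp v \<noteq> 1" using exp_eq_1_strip 1 2 by blast
    then show "exp (- v) \<noteq> 1" by (simp add: exp_minus)
  qed
  define J where "J = (\<lambda>v. dilog_primitive (v + 2 * pi * \<i>) - dilog_primitive v)"
  define Q where "Q = (\<lambda>v. exp (J v * inverse (2 * pi * \<i>)) * (1 - exp v))"
  have "\<exists>c. \<forall>v\<in>T. Q v = c"
  proof (rule has_field_derivative_zero_constant[OF T])
    fix v assume v: "v \<in> T"
    note s = strip[OF v]
    have per: "exp (- (v + 2 * pi * \<i>)) = exp (- v)"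
      using exp_two_pi_i by (simp add: exp_diff)
    have dJ: "(J has_field_derivative (2 * pi * \<i> / (exp (- v) - 1))) (at v)"
      unfolding J_def
      apply (rule derivative_eq_intros DERIV_chain2[OF DERIV_dilog_primitive] DERIV_dilog_primitive s refl)+
      using s per by (simp add: dilog_integrand_def diff_divide_distrib[symmetric])
    \<comment> \<open>The logarithmic derivative of the exponential factor is exp v / (1 - exp v),
      opposite to that of 1 - exp v.\<close>
    have k: "2 * pi * \<i> / (exp (- v) - 1) * inverse (2 * pi * \<i>) * (1 - exp v) = exp v"
      using s by (simp add: exp_minus field_simps)
    have "(Q has_field_derivative exp (J v * inverse (2 * pi * \<i>)) *
        (2 * pi * \<i> / (exp (- v) - 1) * inverse (2 * pi * \<i>) * (1 - exp v) - exp v)) (at v)"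
      unfolding Q_def by (rule derivative_eq_intros dJ refl)+ (simp add: algebra_simps)
    then have "(Q has_field_derivative 0) (at v)" unfolding k by simp
    then show "(Q has_field_derivative 0) (at v within T)" by (rule has_field_derivative_at_within)
  qed
  then obtain c where c: "\<And>v. v \<in> T \<Longrightarrow> Q v = c" by blast
  \<comment> \<open>The midline of \<open>T\<close>: \<open>p s\<close> and its translate by 2 pi i
    have imaginary parts -pi and pi, so the segment between them stays well inside the
    strip.\<close>
  define p where "p = (\<lambda>s. Complex s (- pi))"
  have pT: "p s \<in> T" for s by (simp add: p_def T_def)
  \<comment> \<open>On that segment the real part is s and the imaginary part is at most pi in
    absolute value; the mean value estimate multiplies the bound of the integrand by the length 2
    pi.\<close>
  have bound: "norm (J (p s)) \<le> 2 * pi * ((\<bar>s\<bar> + pi) / (exp (- s) - 1))" if s: "s < 0" for s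
  proof -
    have seg: "norm (dilog_integrand u) \<le> (\<bar>s\<bar> + pi) / (exp (- s) - 1)" if u_in: "u \<in> closed_segment (p s) (p s + 2 * pi * \<i>)" for u
    proof -
      obtain t where t: "0 \<le> t" "t \<le> 1" and u: "u = (1 - t) *\<^sub>R p s + t *\<^sub>R (p s + 2 * pi * \<i>)"
        using u_in unfolding in_segment by metis
      have re: "Re u = s" unfolding u by (simp add: p_def algebra_simps)
      have im: "Im u = - pi + t * (2 * pi)" unfolding u by (simp add: p_def algebra_simps)
      have "t * (2 * pi) \<le> 2 * pi" using t by (simp add: mult_left_le_one_le)
      moreover have "t * (2 * pi) \<ge> 0" using t by simp
      ultimately have "\<bar>Im u\<bar> \<le> pi" unfolding im by linarith
      then have "norm u \<le> \<bar>s\<bar> + pi" using cmod_le[of u] re by simp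
      moreover have "exp (- s) - 1 \<le> norm (exp (- u) - 1)"
        using norm_triangle_ineq2[of "exp (- u)" 1] re by simp
      moreover have "exp (- s) - 1 > 0" using s by simp
      moreover have "u \<noteq> 0" using re s by auto
      moreover have "s \<le> pi" using s pi_gt_zero by linarith
      ultimately show ?thesis
        unfolding dilog_integrand_def by (auto simp: norm_divide intro!: frac_le)
    qed
    have "norm (dilog_primitive (p s + 2 * pi * \<i>) - dilog_primitive (p s)) \<le> (\<bar>s\<bar> + pi) / (exp (- s) - 1) * norm (p s + 2 * pi * \<i> - p s)"
    proof (rule field_differentiable_bound[where f' = dilog_integrand])
      show "convex (closed_segment (p s) (p s + 2 * pi * \<i>))" by simp
      have "closed_segment (p s) (p s + 2 * pi * \<i>) \<subseteq> dilog_strip"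
        using strip(1,2)[OF pT] dilog_strip(2) closed_segment_subset by metis
      then show "(dilog_primitive has_field_derivative dilog_integrand u) (at u within closed_segment (p s) (p s + 2 * pi * \<i>))"
        if "u \<in> closed_segment (p s) (p s + 2 * pi * \<i>)" for u
        using that DERIV_dilog_primitive has_field_derivative_at_within by blast
    qed (use seg in auto)
    then show ?thesis by (simp add: J_def norm_mult mult_ac)
  qed
  have "((\<lambda>s. J (p s)) \<longlongrightarrow> 0) at_bot"
  proof (rule Lim_null_comparison)
    show "\<forall>\<^sub>F s in at_bot. norm (J (p s)) \<le> 2 * pi * ((\<bar>s\<bar> + pi) / (exp (- s) - 1))"
      using eventually_gt_at_bot[of 0] by eventually_elim (rule bound)
    show "((\<lambda>s. 2 * pi * ((\<bar>s\<bar> + pi) / (exp (- s) - 1))) \<longlongrightarrow> 0) at_bot"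
      by real_asymp
  qed
  moreover have "((\<lambda>s. exp (p s)) \<longlongrightarrow> 0) at_bot"
  proof (rule tendsto_norm_zero_cancel)
    have "norm (exp (p s)) = exp s" for s by (simp add: p_def)
    then show "((\<lambda>s. norm (exp (p s))) \<longlongrightarrow> 0) at_bot" by (simp add: exp_at_bot)
  qed
  ultimately have "((\<lambda>s. Q (p s)) \<longlongrightarrow> exp (0 * inverse (2 * pi * \<i>)) * (1 - 0)) at_bot"
    unfolding Q_def by (intro tendsto_mult tendsto_exp tendsto_diff tendsto_const)
  then have "c = 1"
    using c pT by (simp add: tendsto_const_iff)
  moreover have "v \<in> T" using assms by (simp add: T_def)
  ultimately have "Q v = 1" using c by simp
  moreover have "Q v = expdilog (v + 2 * pi * \<i>) / expdilog v * (1 - exp v)"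
    unfolding Q_def J_def expdilog_def exp_diff[symmetric] by (simp only: divide_inverse left_diff_distrib)
  moreover have "expdilog v \<noteq> 0" by (simp only: expdilog_def exp_not_eq_zero not_False_eq_True)
  ultimately show ?thesis by (metis nonzero_mult_div_cancel_left mult.commute times_divide_eq_left mult_1_right nonzero_eq_divide_eq)
qed


text \<open>The term \<open>- k u\<close> is the factor \<open>(1 - exp v)\<^sup>-\<^sup>k\<close> by which translation by \<open>2 \<pi> \<i> k\<close>
  changes the exponentiated dilogarithm, so that all sheets agree where they overlap.\<close>
definition rogers_sheet :: "int \<Rightarrow> complex \<times> complex \<Rightarrow> complex" where
  "rogers_sheet k w = exp (fst w * snd w / (4 * pi * \<i>) - of_int k * fst w) * expdilog (snd w - 2 * pi * \<i> * of_int k)"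

text \<open>Up to a constant factor this is the exponential of (Li_2(z) + u v / 2) / (2 pi i).
  Rounding selects the nearest strip; \<open>rogers_eq_sheet\<close> shows that every sheet defined
  at the point gives the same value.\<close>

definition rogers :: "complex \<times> complex \<Rightarrow> complex" where
  "rogers w = rogers_sheet (round (Im (snd w) / (2 * pi))) w"

section \<open>Gluing the sheets\<close>

lemma expdilog_nonzero [simp]: "expdilog v \<noteq> 0"
  by (simp add: expdilog_def)

lemma rogers_nonzero [simp]: "rogers w \<noteq> 0"
  by (simp add: rogers_def rogers_sheet_def)

text \<open>On the overlap of the two strips, \<open>expdilog_shift\<close> contributes the factor 1
  - exp v = exp u, which the term \<open>- k u\<close> compensates.\<close>

lemma rogers_sheet_Suc:
  assumes "exp u + exp v = 1" "\<bar>Im v - 2 * pi * k\<bar> < 2 * pi" "\<bar>Im v - 2 * pi * (k + 1)\<bar> < 2 * pi"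
  shows "rogers_sheet k (u, v) = rogers_sheet (k + 1) (u, v)"
proof -
  define w where "w = v - 2 * pi * \<i> * of_int (k + 1)"
  have im: "Im w = Im v - 2 * pi * (k + 1)" by (simp add: w_def)
  have e: "2 * pi * of_int (k + 1) = 2 * pi * k + 2 * pi" "2 * pi * (of_int k + 1) = 2 * pi * k + 2 * pi"
    by (simp_all add: algebra_simps)
  have "- 2 * pi < Im w" using assms(2,3) unfolding im e by linarith
  moreover have "Im w < 0" using assms(2,3) unfolding im e by linarith
  ultimately have "expdilog (w + 2 * pi * \<i>) * (1 - exp w) = expdilog w" by (rule expdilog_shift)
  moreover have "exp w = exp v"
    using exp_integer_2pi[of "of_int (k + 1)"] by (simp add: w_def exp_diff mult_ac)
  moreover have "1 - exp v = exp u" using assms(1) by (simp add: algebra_simps)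
  ultimately have "expdilog w = expdilog (w + 2 * pi * \<i>) * exp u" by metis
  moreover have "w + 2 * pi * \<i> = v - 2 * pi * \<i> * of_int k" by (simp add: w_def algebra_simps)
  ultimately have "expdilog w = expdilog (v - 2 * pi * \<i> * of_int k) * exp u" by metis
  then have 1: "expdilog (v - 2 * pi * \<i> * of_int (k + 1)) = expdilog (v - 2 * pi * \<i> * of_int k) * exp u"
    by (simp only: w_def)
  have "exp (u * v / (4 * pi * \<i>) - of_int (k + 1) * u) * exp u = exp (u * v / (4 * pi * \<i>) - of_int k * u)"
    unfolding exp_add[symmetric] by (rule arg_cong[where f = exp]) (simp add: algebra_simps)
  then show ?thesis unfolding rogers_sheet_def fst_conv snd_conv 1 by (simp add: mult_ac)
qed

text \<open>Rounding is off by at most 1/2 and \<open>k\<close> by less than 1 from Im v / (2 pi),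
  so the two sheets are equal or adjacent.\<close>

lemma rogers_eq_sheet:
  assumes "exp u + exp v = 1" "\<bar>Im v - 2 * pi * k\<bar> < 2 * pi"
  shows "rogers (u, v) = rogers_sheet k (u, v)"
proof -
  define t where "t = Im v / (2 * pi)"
  define r where "r = round t"
  have close: "\<bar>Im v - 2 * pi * j\<bar> < 2 * pi \<longleftrightarrow> \<bar>t - j\<bar> < 1" for j :: int
  proof -
    have "Im v - 2 * pi * j = 2 * pi * (t - j)" by (simp add: t_def algebra_simps)
    then show ?thesis by (simp add: abs_mult)
  qed
  have r: "\<bar>t - r\<bar> \<le> 1 / 2" unfolding r_def using of_int_round_abs_le[of t] by (simp add: abs_minus_commute)
  moreover have "\<bar>t - k\<bar> < 1" using assms(2) close by simp
  ultimately have "\<bar>of_int k - of_int r :: real\<bar> < 2" by linarith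
  then have "k = r - 1 \<or> k = r \<or> k = r + 1" by linarith
  moreover have "\<bar>Im v - 2 * pi * r\<bar> < 2 * pi" unfolding close using r by linarith
  ultimately have "rogers_sheet r (u, v) = rogers_sheet k (u, v)"
    using rogers_sheet_Suc[OF assms(1), of r] rogers_sheet_Suc[OF assms(1), of k] assms(2) by auto
  then show ?thesis by (simp add: rogers_def r_def t_def)
qed

lemma ex_near_sheet: "\<exists>k::int. \<bar>Im v - 2 * pi * k\<bar> < 2 * pi"
proof -
  have "\<bar>of_int (round (Im v / (2 * pi))) - Im v / (2 * pi)\<bar> < 1"
    using of_int_round_abs_le[of "Im v / (2 * pi)"] by linarith
  then have "2 * pi * \<bar>of_int (round (Im v / (2 * pi))) - Im v / (2 * pi)\<bar> < 2 * pi * 1"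
    by (intro mult_strict_left_mono) auto
  also have "2 * pi * \<bar>of_int (round (Im v / (2 * pi))) - Im v / (2 * pi)\<bar> = \<bar>2 * pi * (of_int (round (Im v / (2 * pi))) - Im v / (2 * pi))\<bar>"
    by (simp add: abs_mult)
  also have "2 * pi * (of_int (round (Im v / (2 * pi))) - Im v / (2 * pi)) = 2 * pi * of_int (round (Im v / (2 * pi))) - Im v"
    by (simp add: algebra_simps)
  finally show ?thesis by (intro exI[of _ "round (Im v / (2 * pi))"]) (simp add: abs_minus_commute)
qed

text \<open>Passing from sheet k to sheet k - 1 keeps the argument of \<open>expdilog\<close>; the
  exponent loses u/2 in the product u v / (4 pi i) and gains u from the sheet number.\<close>

lemma rogers_shift:
  assumes "exp u + exp v = 1"
  shows "rogers (u, v - 2 * pi * \<i>) = rogers (u, v) * exp (u / 2)"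
proof -
  obtain k :: int where k: "\<bar>Im v - 2 * pi * k\<bar> < 2 * pi" using ex_near_sheet by blast
  have ex: "exp u + exp (v - 2 * pi * \<i>) = 1" using assms exp_two_pi_i by (simp add: exp_diff)
  have "\<bar>Im (v - 2 * pi * \<i>) - 2 * pi * (k - 1)\<bar> < 2 * pi" using k by (simp add: algebra_simps)
  then have "rogers (u, v - 2 * pi * \<i>) = rogers_sheet (k - 1) (u, v - 2 * pi * \<i>)"
    using rogers_eq_sheet[OF ex, of "k - 1"] by simp
  also have "\<dots> = rogers_sheet k (u, v) * exp (u / 2)"
  proof -
    have e1: "v - 2 * pi * \<i> - 2 * pi * \<i> * of_int (k - 1) = v - 2 * pi * \<i> * of_int k" by (simp add: algebra_simps)
    have e2: "u * (v - 2 * pi * \<i>) / (4 * pi * \<i>) - of_int (k - 1) * u = (u * v / (4 * pi * \<i>) - of_int k * u) + u / 2"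
    proof -
      have "u * (v - 2 * pi * \<i>) / (4 * pi * \<i>) = u * v / (4 * pi * \<i>) - u / 2" by (simp add: field_simps)
      moreover have "X - u / 2 - of_int (k - 1) * u = (X - of_int k * u) + u / 2" for X :: complex
        by (simp add: field_simps)
      ultimately show ?thesis by metis
    qed
    show ?thesis unfolding rogers_sheet_def fst_conv snd_conv e1 e2 exp_add by (simp only: mult_ac)
  qed
  finally show ?thesis using rogers_eq_sheet[OF assms k] by simp
qed

section \<open>Logarithmic derivatives along paths\<close>

definition has_log_derivative :: "(real \<Rightarrow> complex) \<Rightarrow> complex \<Rightarrow> real \<Rightarrow> bool" where
  "has_log_derivative f d t \<longleftrightarrow> f t \<noteq> 0 \<and> (f has_vector_derivative f t * d) (at t within {0..1})"

lemma has_log_derivative_exp: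
  assumes "(h has_vector_derivative d) (at t within {0..1})"
  shows "has_log_derivative (\<lambda>s. exp (h s)) d t"
  using field_vector_diff_chain_within[OF assms has_field_derivative_at_within[OF DERIV_exp]]
  by (simp add: has_log_derivative_def o_def mult.commute)

lemma has_log_derivative_mult:
  assumes "has_log_derivative f d t" "has_log_derivative g e t"
  shows "has_log_derivative (\<lambda>s. f s * g s) (d + e) t"
proof -
  have "((\<lambda>s. f s * g s) has_vector_derivative (f t * (g t * e) + f t * d * g t)) (at t within {0..1})"
    using assms by (intro has_vector_derivative_mult) (auto simp: has_log_derivative_def)
  then show ?thesis using assms by (simp add: has_log_derivative_def algebra_simps)
qed

lemma has_log_derivative_inverse:
  assumes "has_log_derivative f d t"
  shows "has_log_derivative (\<lambda>s. inverse (f s)) (- d) t"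
proof -
  have f: "f t \<noteq> 0" "(f has_vector_derivative f t * d) (at t within {0..1})"
    using assms by (auto simp: has_log_derivative_def)
  have "((inverse \<circ> f) has_vector_derivative (f t * d) * - (inverse (f t) * inverse (f t))) (at t within {0..1})"
    using f(1) by (intro field_vector_diff_chain_within[OF f(2)]) (auto intro!: derivative_eq_intros)
  then show ?thesis using f(1) by (simp add: has_log_derivative_def o_def field_simps)
qed

text \<open>On sheet k, \<open>h\<close> is a logarithm of the function. The dilogarithm term
  contributes - w U' / (2 pi i) with w = V - 2 pi i k; its constant part cancels - k U', so the
  result is the same for every sheet.\<close>

lemma rogers_log_derivative:
  assumes U: "(U has_vector_derivative U') (at t within {0..1})"
    and V: "(V has_vector_derivative V') (at t within {0..1})"
    and curve: "\<And>s. s \<in> {0..1} \<Longrightarrow> exp (U s) + exp (V s) = 1" and t: "t \<in> {0..1}"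
  shows "has_log_derivative (\<lambda>s. rogers (U s, V s)) ((U t * V' - V t * U') / (4 * pi * \<i>)) t"
proof -
  obtain k :: int where k: "\<bar>Im (V t) - 2 * pi * k\<bar> < 2 * pi" using ex_near_sheet by blast
  define w where "w = V t - 2 * pi * \<i> * of_int k"
  have w: "w \<in> dilog_strip" using k by (simp add: w_def dilog_strip_def)
  have expw: "exp w = exp (V t)"
    using exp_integer_2pi[of "of_int k"] by (simp add: w_def exp_diff mult_ac)
  have curve_t: "exp (U t) = 1 - exp (V t)" using curve[OF t] by (simp add: algebra_simps)
  have "exp w \<noteq> 1" using curve_t expw using exp_not_eq_zero[of "U t"] by auto
  then have "w \<noteq> 0" and em: "exp (- w) \<noteq> 1" by (auto simp: exp_minus)
  define W where "W = (\<lambda>s. V s - 2 * pi * \<i> * of_int k)"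
  have Wt: "W t = w" by (simp only: W_def w_def)
  have dW: "(W has_vector_derivative V') (at t within {0..1})"
    unfolding W_def using has_vector_derivative_diff[OF V has_vector_derivative_const] by simp
  have dw: "(dilog_primitive has_field_derivative w / (exp (- w) - 1)) (at w within X)" for X
    using has_field_derivative_at_within[OF DERIV_dilog_primitive[OF w]] \<open>w \<noteq> 0\<close>
    unfolding dilog_integrand_def by simp
  have dG: "((\<lambda>s. dilog_primitive (W s)) has_vector_derivative V' * (w / (exp (- w) - 1))) (at t within {0..1})"
    by (rule field_vector_diff_chain_within[OF dW, unfolded o_def]) (unfold Wt, rule dw)
  \<comment> \<open>Differentiating exp U + exp V = 1 expresses U' by V', which turns the derivative
    of \<open>dilog_primitive\<close> into - w U'.\<close>
  have rel: "U' = - (V' / (exp (- w) - 1))"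
  proof -
    have "((\<lambda>s. exp (U s) + exp (V s)) has_vector_derivative exp (U t) * U' + exp (V t) * V') (at t within {0..1})"
      using has_log_derivative_exp[OF U] has_log_derivative_exp[OF V]
      by (intro has_vector_derivative_add) (auto simp: has_log_derivative_def)
    moreover have "((\<lambda>s. exp (U s) + exp (V s)) has_vector_derivative 0) (at t within {0..1})"
      by (rule has_vector_derivative_transform_within[OF has_vector_derivative_const, of 1 _ _ 1]) (use curve t in auto)
    ultimately have "exp (U t) * U' + exp (V t) * V' = 0"
      using vector_derivative_unique_within_closed_interval[of 0 1 t] t by auto
    then have "(1 - exp w) * U' = - (exp w * V')"
      unfolding curve_t expw[symmetric] by (simp add: eq_neg_iff_add_eq_0)
    then have "U' = - (exp w * V') / (1 - exp w)"
      using \<open>exp w \<noteq> 1\<close> by (metis nonzero_mult_div_cancel_left right_minus_eq)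
    also have "\<dots> = - (V' / (exp (- w) - 1))"
      using \<open>exp w \<noteq> 1\<close> em by (simp add: exp_minus divide_simps)
    finally show ?thesis .
  qed
  define h where "h = (\<lambda>s. U s * V s / (4 * pi * \<i>) - of_int k * U s + dilog_primitive (W s) / (2 * pi * \<i>))"
  have "(h has_vector_derivative ((U t * V' + U' * V t) / (4 * pi * \<i>) - of_int k * U' + V' * (w / (exp (- w) - 1)) / (2 * pi * \<i>))) (at t within {0..1})"
    unfolding h_def
    by (intro has_vector_derivative_add has_vector_derivative_diff has_vector_derivative_divide has_vector_derivative_mult
        has_vector_derivative_mult_right dG U V)
  also have "(U t * V' + U' * V t) / (4 * pi * \<i>) - of_int k * U' + V' * (w / (exp (- w) - 1)) / (2 * pi * \<i>)
      = (U t * V' - V t * U') / (4 * pi * \<i>)"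
  proof -
    have "V' * (w / (exp (- w) - 1)) = - (U' * w)" unfolding rel by simp
    moreover have "- (U' * w) / (2 * pi * \<i>) = - (U' * V t) / (2 * pi * \<i>) + of_int k * U'"
      by (simp add: w_def field_simps)
    ultimately show ?thesis by (simp add: field_simps)
  qed
  finally have "has_log_derivative (\<lambda>s. exp (h s)) ((U t * V' - V t * U') / (4 * pi * \<i>)) t"
    by (rule has_log_derivative_exp)
  moreover have eh: "exp (h s) = rogers_sheet k (U s, V s)" for s
    by (simp add: h_def W_def rogers_sheet_def expdilog_def exp_add)
  \<comment> \<open>The strip condition is open, so sheet k computes \<open>rogers\<close> at all
    parameters near \<open>t\<close>.\<close>
  moreover obtain d where "d > 0" and d: "\<And>s. s \<in> {0..1} \<Longrightarrow> dist s t < d \<Longrightarrow> \<bar>Im (V s) - 2 * pi * k\<bar> < 2 * pi"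
  proof -
    have "continuous (at t within {0..1}) (\<lambda>s. \<bar>Im (V s) - 2 * pi * k\<bar>)"
      using has_vector_derivative_continuous[OF V] by (intro continuous_intros continuous_Im)
    then have "\<forall>\<^sub>F s in at t within {0..1}. \<bar>Im (V s) - 2 * pi * k\<bar> < 2 * pi"
      using k unfolding continuous_within by (rule order_tendstoD)
    then obtain d where "d > 0" "\<forall>s\<in>{0..1}. s \<noteq> t \<and> dist s t < d \<longrightarrow> \<bar>Im (V s) - 2 * pi * k\<bar> < 2 * pi"
      unfolding eventually_at by blast
    then show thesis using that k by metis
  qed
  moreover have "rogers (U s, V s) = rogers_sheet k (U s, V s)" if "s \<in> {0..1}" "dist s t < d" for s
    using rogers_eq_sheet[OF curve d] that by blast
  ultimately show ?thesis
    using t \<open>d > 0\<close> unfolding has_log_derivative_def eh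
    by (auto intro: has_vector_derivative_transform_within)
qed


section \<open>Constancy of the five-term product\<close>

definition rogers_five :: "(complex \<times> complex) ^ 5 \<Rightarrow> complex" where
  "rogers_five w = rogers (w $ 1) * inverse (rogers (w $ 2)) * rogers (w $ 3) * inverse (rogers (w $ 4)) * rogers (w $ 5)"

text \<open>The derivative vanishes because \<open>\<Sum> (-1)^i u_i \<and> v_i = 0\<close> on the linear space cut out by
  the relations between the logarithms.\<close>
lemma rogers_five_path:
  fixes g g' :: "real \<Rightarrow> complex ^ 5"
  assumes deriv: "\<And>t i. t \<in> {0..1} \<Longrightarrow> ((\<lambda>s. g s $ i) has_vector_derivative g' t $ i) (at t within {0..1})"
    and cover: "\<And>t. t \<in> {0..1} \<Longrightarrow> (p t, g t) \<in> FT_cover"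
  shows "rogers_five (FT_point (g 0)) = rogers_five (FT_point (g 1))"
proof -
  have curve: "exp (fst (FT_point (g t) $ i)) + exp (snd (FT_point (g t) $ i)) = 1" if "t \<in> {0..1}" for t i
    using FT_point_in_FT_lift[OF cover[OF that]] by (auto simp: FT_lift_def Chat_iff)
  have "((\<lambda>t. rogers_five (FT_point (g t))) has_vector_derivative 0) (at t within {0..1})" if t: "t \<in> {0..1}" for t
  proof -
    define c where "c = 4 * pi * \<i>"
    define a b e d h where "a = g t $ 1" and "b = g t $ 2" and "e = g t $ 3" and "d = g t $ 4" and "h = g t $ 5"
    define a' b' e' d' h' where "a' = g' t $ 1" and "b' = g' t $ 2" and "e' = g' t $ 3" and "d' = g' t $ 4" and "h' = g' t $ 5"
    note defs = a_def b_def e_def d_def h_def a'_def b'_def e'_def d'_def h'_def c_def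
    have 1: "has_log_derivative (\<lambda>s. rogers (g s $ 1, g s $ 2)) ((a * b' - b * a') / c) t"
      unfolding defs using curve[of _ 1] t
      by (intro rogers_log_derivative deriv) (auto simp: FT_point_def)
    have 2: "has_log_derivative (\<lambda>s. rogers (g s $ 3, g s $ 4)) ((e * d' - d * e') / c) t"
      unfolding defs using curve[of _ 2] t
      by (intro rogers_log_derivative deriv) (auto simp: FT_point_def)
    have 3: "has_log_derivative (\<lambda>s. rogers (g s $ 3 - g s $ 1, g s $ 5 - g s $ 1))
        (((e - a) * (h' - a') - (h - a) * (e' - a')) / c) t"
      unfolding defs using curve[of _ 3] t
      by (intro rogers_log_derivative has_vector_derivative_diff deriv) (auto simp: FT_point_def)
    have 4: "has_log_derivative (\<lambda>s. rogers (g s $ 3 - g s $ 1 + g s $ 2 - g s $ 4, g s $ 5 - g s $ 1 - g s $ 4))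
        (((e - a + b - d) * (h' - a' - d') - (h - a - d) * (e' - a' + b' - d')) / c) t"
      unfolding defs using curve[of _ 4] t
      by (intro rogers_log_derivative has_vector_derivative_diff has_vector_derivative_add deriv) (auto simp: FT_point_def)
    have 5: "has_log_derivative (\<lambda>s. rogers (g s $ 2 - g s $ 4, g s $ 5 - g s $ 4))
        (((b - d) * (h' - d') - (h - d) * (b' - d')) / c) t"
      unfolding defs using curve[of _ 5] t
      by (intro rogers_log_derivative has_vector_derivative_diff deriv) (auto simp: FT_point_def)
    let ?d = "(a * b' - b * a') / c + - ((e * d' - d * e') / c) + ((e - a) * (h' - a') - (h - a) * (e' - a')) / c
      + - (((e - a + b - d) * (h' - a' - d') - (h - a - d) * (e' - a' + b' - d')) / c)
      + ((b - d) * (h' - d') - (h - d) * (b' - d')) / c"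
    have "has_log_derivative (\<lambda>t. rogers_five (FT_point (g t))) ?d t"
      unfolding rogers_five_def FT_point_def vector_5
      by (intro has_log_derivative_mult has_log_derivative_inverse 1 2 3 4 5)
    moreover have "?d = 0"
      unfolding minus_divide_left add_divide_distrib[symmetric] by (simp add: algebra_simps)
    ultimately show ?thesis by (simp add: has_log_derivative_def)
  qed
  then show ?thesis
    using has_vector_derivative_zero_constant[of "{0..1}" "\<lambda>t. rogers_five (FT_point (g t))"]
    by (metis atLeastAtMost_iff convex_real_interval(5) order_refl zero_le_one)
qed

text \<open>A nearby point of the cover is reached from \<open>(p0, w0)\<close> by lifting the
  straight segment in the base, and \<open>rogers_five_path\<close> applies to the lift.\<close>

lemma rogers_five_locally_constant:
  assumes p0: "(p0, w0) \<in> FT_cover"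
  shows "\<forall>\<^sub>F q in at (p0, w0) within FT_cover. rogers_five (FT_point w0) = rogers_five (FT_point (snd q))"
proof -
  have p0': "p0 \<in> FT_base" using p0 by (simp add: FT_cover_def log_cover_def)
  obtain r where r: "r > 0" "ball p0 r \<subseteq> FT_base" "\<And>y j. y \<in> ball p0 r \<Longrightarrow> FT_units j y / FT_units j p0 \<notin> \<real>\<^sub>\<le>\<^sub>0"
    using FT.local_ball[OF p0'] by blast
  have nz0: "FT_units j p0 \<noteq> 0" for j using FT.nz[OF p0'] .
  have near: "rogers_five (FT_point w0) = rogers_five (FT_point w)"
    if q: "(p, w) \<in> FT_cover" "dist p p0 < r" "dist w w0 < pi" for p w
  proof -
    define l where "l = (\<lambda>s. p0 + s *\<^sub>R (p - p0))"
    have l: "l s \<in> ball p0 r" if "s \<in> {0..1}" for s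
    proof -
      have "norm (s *\<^sub>R (p - p0)) \<le> norm (p - p0)" using that by (simp add: mult_left_le_one_le)
      then show ?thesis using q(2) by (simp add: l_def dist_norm)
    qed
    define m where "m = (\<lambda>j. FT_units j p - FT_units j p0)"
    \<comment> \<open>All five units are affine functions of (x, y), hence affine in the parameter
      of the segment.\<close>
    have lin: "FT_units j (l s) = FT_units j p0 + of_real s * m j" for j s
      using exhaust_5[of j]
      by (elim disjE; simp only: FT_units_def vector_5 l_def m_def; simp add: scaleR_conv_of_real algebra_simps)
    define g where "g = (\<lambda>s. \<chi> j. w0 $ j + Ln (FT_units j (l s) / FT_units j p0))"
    define g' where "g' = (\<lambda>s. \<chi> j. m j / FT_units j p0 * inverse (FT_units j (l s) / FT_units j p0))"
    have g0: "g 0 = w0" using nz0 by (simp add: g_def l_def vec_eq_iff)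
    have cover: "(l s, g s) \<in> FT_cover" if "s \<in> {0..1}" for s
    proof -
      have ls: "l s \<in> FT_base" using l[OF that] r by blast
      have "exp (w0 $ j) = FT_units j p0" for j using p0 by (simp add: FT_cover_def log_cover_iff)
      then show ?thesis
        using ls FT.nz[OF ls] nz0 by (simp add: FT_cover_def log_cover_iff g_def exp_add)
    qed
    \<comment> \<open>The lift ends at some point over \<open>p\<close>; since \<open>w\<close> is
      within pi of \<open>w0\<close> and a principal logarithm has imaginary part at most pi in
      absolute value, no multiple of 2 pi i can intervene.\<close>
    have g1: "g 1 = w"
    proof -
      have "g 1 $ j = w $ j" for j
      proof (rule exp_complex_eqI)
        have "(l 1, g 1) \<in> FT_cover" by (rule cover) simp
        then show "exp (g 1 $ j) = exp (w $ j)" using q(1) by (simp add: FT_cover_def log_cover_iff l_def)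
        have "FT_units j (l 1) / FT_units j p0 \<noteq> 0" using r(3)[OF l, of 1 j] by auto
        then have "\<bar>Im (Ln (FT_units j (l 1) / FT_units j p0))\<bar> \<le> pi"
          using mpi_less_Im_Ln Im_Ln_le_pi by (simp add: abs_le_iff less_imp_le minus_le_iff)
        moreover have "\<bar>Im (w0 $ j) - Im (w $ j)\<bar> < pi"
          using abs_Im_le_cmod[of "w $ j - w0 $ j"] Finite_Cartesian_Product.norm_nth_le[of "w - w0" j] q(3)
          by (simp add: dist_norm abs_minus_commute)
        ultimately show "\<bar>Im (g 1 $ j) - Im (w $ j)\<bar> < 2 * pi" by (simp add: g_def)
      qed
      then show ?thesis by (simp add: vec_eq_iff)
    qed
    have "((\<lambda>s. g s $ i) has_vector_derivative g' t $ i) (at t within {0..1})" if t: "t \<in> {0..1}" for t i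
    proof -
      have d0: "((\<lambda>s. FT_units i (l s) / FT_units i p0) has_vector_derivative m i / FT_units i p0) (at t within {0..1})"
        unfolding lin by (rule derivative_eq_intros refl | simp)+
      have dl: "(Ln has_field_derivative inverse (FT_units i (l t) / FT_units i p0)) (at (FT_units i (l t) / FT_units i p0) within X)" for X
        by (rule has_field_derivative_at_within, rule has_field_derivative_Ln, rule r(3)[OF l[OF t]])
      have d: "((Ln \<circ> (\<lambda>s. FT_units i (l s) / FT_units i p0)) has_vector_derivative
          m i / FT_units i p0 * inverse (FT_units i (l t) / FT_units i p0)) (at t within {0..1})"
        by (rule field_vector_diff_chain_within[OF d0 dl])
      show ?thesis
        using has_vector_derivative_add[OF has_vector_derivative_const d, of "w0 $ i"]
        unfolding g_def g'_def vec_lambda_beta o_def add_0 .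
    qed
    from rogers_five_path[OF this cover] show ?thesis unfolding g0 g1 .
  qed
  have "\<forall>q\<in>FT_cover. q \<noteq> (p0, w0) \<and> dist q (p0, w0) < min r pi \<longrightarrow> rogers_five (FT_point w0) = rogers_five (FT_point (snd q))"
  proof (intro ballI impI)
    fix q assume q: "q \<in> FT_cover" "q \<noteq> (p0, w0) \<and> dist q (p0, w0) < min r pi"
    obtain p w where pw: "q = (p, w)" by (cases q)
    have "dist p p0 \<le> dist q (p0, w0)" "dist w w0 \<le> dist q (p0, w0)"
      using dist_fst_le[of q "(p0, w0)"] dist_snd_le[of q "(p0, w0)"] by (simp_all add: pw)
    then show "rogers_five (FT_point w0) = rogers_five (FT_point (snd q))"
      using near[of p w] q pw by auto
  qed
  then show ?thesis using r(1) pi_gt_zero unfolding eventually_at by (intro exI[of _ "min r pi"]) auto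
qed

text \<open>The coefficients of the five-term relation sum to 1, so dividing \<open>rogers\<close>
  by c turns this into an exact relation.\<close>

lemma rogers_five_constant: "\<exists>c. c \<noteq> 0 \<and> (\<forall>w \<in> FT_hat. rogers_five w = c)"
proof -
  have const: "rogers_five (FT_point (snd p)) = rogers_five (FT_point (snd q))" if "p \<in> FT_cover" "q \<in> FT_cover" for p q
  proof (rule connected_local_const[OF connected_FT_cover that])
    show "\<forall>a\<in>FT_cover. \<forall>\<^sub>F b in at a within FT_cover. rogers_five (FT_point (snd a)) = rogers_five (FT_point (snd b))"
    proof
      fix a assume "a \<in> FT_cover"
      then show "\<forall>\<^sub>F b in at a within FT_cover. rogers_five (FT_point (snd a)) = rogers_five (FT_point (snd b))"
        using rogers_five_locally_constant[of "fst a" "snd a"] by simp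
    qed
  qed
  obtain v where v: "v \<in> FT_plus" using FT_plus_nonempty by blast
  obtain p w where "(p, w) \<in> FT_cover" using principal_FT_point[OF v] by metis
  then obtain q where q: "q \<in> FT_cover" by metis
  show ?thesis
  proof (intro exI conjI ballI)
    show "rogers_five (FT_point (snd q)) \<noteq> 0" by (simp add: rogers_five_def)
    show "rogers_five w = rogers_five (FT_point (snd q))" if w: "w \<in> FT_hat" for w
    proof -
      obtain q' where q': "q' \<in> FT_cover" "w = FT_point (snd q')" using w unfolding FT_hat_eq by blast
      show ?thesis unfolding q'(2) by (rule const[OF q'(1) q])
    qed
  qed
qed


section \<open>Consequences of the five-term relation\<close>

lemma exp_shift_2pi_i: "exp (v - 2 * pi * \<i>) = exp v" "exp (v + 2 * pi * \<i>) = exp v"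
  using exp_two_pi_i by (simp_all add: exp_diff exp_add)

text \<open>Here a, b, c, d, e are arbitrary logarithms of x, 1 - x, y, 1 - y, 1 - y/x. The freedom
  to shift each of them by 2 pi i separately drives everything that follows.\<close>

locale five_term_function =
  fixes \<phi> :: "complex \<Rightarrow> complex \<Rightarrow> 'g :: ab_group_add"
  assumes five_term:
    "exp a + exp b = 1 \<Longrightarrow> exp c + exp d = 1 \<Longrightarrow> exp (c - a) + exp e = 1 \<Longrightarrow>
      \<phi> a b - \<phi> c d + \<phi> (c - a) e - \<phi> (c - a + b - d) (e - d) + \<phi> (b - d) (e - d + a) = 0"
begin

lemma five_term_curves:
  fixes a b c d e :: complex
  assumes "exp a + exp b = 1" "exp c + exp d = 1" "exp (c - a) + exp e = 1"
  shows "exp (b - d) + exp (e - d + a) = 1" "exp (c - a + b - d) + exp (e - d) = 1"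
proof -
  define x y z where "x = exp a" and "y = exp c" and "z = exp e"
  have b: "exp b = 1 - x" and d: "exp d = 1 - y" using assms by (simp_all add: x_def y_def algebra_simps)
  have nz: "x \<noteq> 0" "1 - y \<noteq> 0" using d[symmetric] by (simp_all add: x_def)
  have z: "y / x + z = 1" using assms(3) by (simp add: exp_diff x_def y_def z_def)
  then have zx: "z * x = x - y" using nz by (simp add: field_simps)
  have "exp (b - d) + exp (e - d + a) = ((1 - x) + z * x) / (1 - y)"
    by (simp add: exp_diff exp_add b d x_def z_def add_divide_distrib)
  then show "exp (b - d) + exp (e - d + a) = 1" using nz by (simp add: zx)
  have "exp (c - a + b - d) + exp (e - d) = (y / x * (1 - x) + z) / (1 - y)"
    by (simp add: exp_diff exp_add b d x_def y_def z_def add_divide_distrib)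
  also have "y / x * (1 - x) + z = (y / x + z) - y" using nz(1) by (simp add: field_simps)
  finally show "exp (c - a + b - d) + exp (e - d) = 1" using nz by (simp add: z)
qed

text \<open>Realises s and t as first coordinates of the third and fifth terms, that of the fourth
  being s + t. With X = exp s and T = exp t the condition is 1 - x = T (1 - x X), solved by x = (1 -
  T) / (1 - T X).\<close>

lemma five_term_solution:
  fixes s t :: complex
  assumes "exp s \<noteq> 1" "exp t \<noteq> 1" "exp (s + t) \<noteq> 1"
  obtains a b where "exp a + exp b = 1" "exp (a + s) + exp (b - t) = 1"
proof -
  define X T where "X = exp s" and "T = exp t"
  have TX: "T * X = exp (s + t)" by (simp add: X_def T_def exp_add mult.commute)
  have XT: "X \<noteq> 0" "T \<noteq> 0" "X \<noteq> 1" "T \<noteq> 1" "1 - T * X \<noteq> 0"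
    using assms unfolding TX by (simp_all add: X_def T_def)
  define x where "x = (1 - T) / (1 - T * X)"
  have x: "x * (1 - T * X) = 1 - T" using XT(5) by (simp add: x_def)
  then have rel: "1 - x = T * (1 - x * X)" by (simp add: algebra_simps)
  have "x \<noteq> 0" using XT by (simp add: x_def)
  have "x \<noteq> 1" using x XT(2,3) by auto
  show thesis
  proof
    show "exp (Ln x) + exp (Ln (1 - x)) = 1" using \<open>x \<noteq> 0\<close> \<open>x \<noteq> 1\<close> by simp
    show "exp (Ln x + s) + exp (Ln (1 - x) - t) = 1"
      using \<open>x \<noteq> 0\<close> \<open>x \<noteq> 1\<close> XT(2) by (simp add: exp_add exp_diff flip: X_def T_def) (simp add: rel)
  qed
qed

section \<open>Dependence on the second logarithm\<close>

definition Delta0 :: "complex \<Rightarrow> 'g" where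
  "Delta0 u = \<phi> u (Ln (1 - exp u) - 2 * pi * \<i>) - \<phi> u (Ln (1 - exp u))"

text \<open>Changing e affects only the last three terms; subtract the two relations.\<close>

lemma five_term_shift_e:
  assumes "exp a + exp b = 1" "exp c + exp d = 1" "exp (c - a) + exp e = 1"
  shows "(\<phi> (c - a) (e - 2 * pi * \<i>) - \<phi> (c - a) e) +
      (\<phi> (b - d) (e - d + a - 2 * pi * \<i>) - \<phi> (b - d) (e - d + a)) =
      \<phi> (c - a + b - d) (e - d - 2 * pi * \<i>) - \<phi> (c - a + b - d) (e - d)"
proof -
  have "exp (c - a) + exp (e - 2 * pi * \<i>) = 1" using assms(3) by (simp only: exp_shift_2pi_i)
  from five_term[OF assms(1,2) this]
  have "\<phi> a b - \<phi> c d + \<phi> (c - a) (e - 2 * pi * \<i>) - \<phi> (c - a + b - d) (e - d - 2 * pi * \<i>)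
    + \<phi> (b - d) (e - d + a - 2 * pi * \<i>) = 0"
    by (simp add: algebra_simps)
  moreover have "(x' - x) + (z' - z) = y' - y" if "p - q + x' - y' + z' = 0" "p - q + x - y + z = 0" for p q x x' y y' z z' :: 'g
  proof -
    have "(x' - x) + (z' - z) - (y' - y) = (p - q + x' - y' + z') - (p - q + x - y + z)" by (simp add: algebra_simps)
    then show ?thesis using that by simp
  qed
  ultimately show ?thesis using five_term[OF assms] by blast
qed

text \<open>The point (u, w) is made the fifth term of a relation whose third and fourth terms do
  not see a shift of w by a multiple of 2 pi i.\<close>

lemma Delta0_eq:
  assumes uv: "exp u + exp v = 1"
  shows "\<phi> u (v - 2 * pi * \<i>) - \<phi> u v = Delta0 u"
proof -
  define T where "T = exp u"
  have T: "T \<noteq> 1" using uv exp_not_eq_zero[of v] by (auto simp: T_def)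
  \<comment> \<open>An auxiliary ratio y/x such that X, T and X T all differ from 1.\<close>
  obtain X :: complex where X: "X \<noteq> 0" "X \<noteq> 1" "X * T \<noteq> 1"
  proof (cases "2 * T = 1")
    case True
    have "3 * T = T + 2 * T" by simp
    also have "\<dots> \<noteq> 1" unfolding True by (simp add: T_def)
    finally show ?thesis using that[of 3] by simp
  next
    case False then show ?thesis using that[of 2] by auto
  qed
  define s where "s = Ln X"
  have s: "exp s = X" using X by (simp add: s_def)
  obtain a b where ab: "exp a + exp b = 1" "exp (a + s) + exp (b - u) = 1"
    by (rule five_term_solution[of s u]) (use X T in \<open>auto simp: exp_add s T_def\<close>)
  define d where "d = b - u"
  have e: "exp s + exp (w + d - a) = 1" if "exp u + exp w = 1" for w
  proof -
    have bd: "exp b = exp u * exp d" by (simp add: d_def exp_diff)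
    have "exp a * X + exp d = 1" using ab(2) by (simp add: exp_add s d_def)
    then have 1: "exp d = 1 - exp a * X" by (simp add: eq_diff_eq add.commute)
    have "exp a + exp u * exp d = 1" using ab(1) bd by simp
    then have 2: "exp u * exp d = 1 - exp a" by (simp add: eq_diff_eq add.commute)
    have "exp w = 1 - exp u" using that by (simp add: eq_diff_eq add.commute)
    then have "exp w * exp d = exp d - exp u * exp d" by (simp add: left_diff_distrib)
    also have "\<dots> = exp a * (1 - X)" unfolding 2 unfolding 1 by (simp add: right_diff_distrib)
    finally have "exp w * exp d = exp a * (1 - X)" .
    then show ?thesis by (simp add: exp_add exp_diff s)
  qed
  \<comment> \<open>Shifting a, and with it c = a + s, by 2 pi i n while e stays fixed moves the
    second coordinate e - d + a of the fifth term by 2 pi i n; c - a, e and e - d are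
    unchanged.\<close>
  have shift: "\<phi> u (w + 2 * pi * \<i> * of_int n - 2 * pi * \<i>) - \<phi> u (w + 2 * pi * \<i> * of_int n) =
      (\<phi> (s + u) (w - a - 2 * pi * \<i>) - \<phi> (s + u) (w - a)) - (\<phi> s (w + d - a - 2 * pi * \<i>) - \<phi> s (w + d - a))"
    if w: "exp u + exp w = 1" for w n
  proof -
    define a' where "a' = a + 2 * pi * \<i> * of_int n"
    have "exp a' = exp a" using exp_integer_2pi[of "of_int n"] by (simp add: a'_def exp_add mult_ac)
    then have 1: "exp a' + exp b = 1" "exp (a' + s) + exp d = 1" using ab by (simp_all add: exp_add d_def)
    have 2: "exp (a' + s - a') + exp (w + d - a) = 1" using e[OF w] by simp
    from five_term_shift_e[OF 1 2] show ?thesis by (simp add: a'_def d_def algebra_simps)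
  qed
  have "exp (Ln (1 - exp u)) = 1 - exp u" using T by (simp add: T_def)
  then have l: "exp u + exp (Ln (1 - exp u)) = 1" by simp
  then have "exp v = exp (Ln (1 - exp u))" using uv by (metis add_left_cancel)
  then obtain n where "v = Ln (1 - exp u) + (of_int (2 * n) * pi) * \<i>" unfolding exp_eq by blast
  then have v: "v = Ln (1 - exp u) + 2 * pi * \<i> * of_int n" by simp
  show ?thesis unfolding v Delta0_def using shift[OF l, of n] shift[OF l, of 0] by simp
qed

lemma Delta0_add:
  assumes "exp s \<noteq> 1" "exp t \<noteq> 1" "exp (s + t) \<noteq> 1"
  shows "Delta0 (s + t) = Delta0 s + Delta0 t"
proof -
  obtain a b where ab: "exp a + exp b = 1" "exp (a + s) + exp (b - t) = 1"
    using five_term_solution[OF assms] by blast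
  have e: "exp (a + s - a) + exp (Ln (1 - exp s)) = 1" using assms by simp
  note c = five_term_curves[OF ab e]
  show ?thesis
    using five_term_shift_e[OF ab e] Delta0_eq[OF e] Delta0_eq[OF c(1)] Delta0_eq[OF c(2)]
    by (simp add: add.commute)
qed

text \<open>\<open>Delta0\<close> is meaningless on \<open>2 \<pi> \<i> \<int>\<close>, where no \<open>v\<close> with \<open>exp u + exp v = 1\<close> exists; there the
  value is forced by additivity.\<close>
definition Delta :: "complex \<Rightarrow> 'g" where
  "Delta u = (if exp u = 1 then Delta0 (u - 1) + Delta0 1 else Delta0 u)"

lemma exp_one_nontrivial [simp]: "exp (1 :: complex) \<noteq> 1" "exp (- 1 :: complex) \<noteq> 1" "exp (2 :: complex) \<noteq> 1"
  by (simp_all add: exp_eq_1)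

text \<open>Transferring k - h from one summand to the other shows that the sum is the same for h
  and k, provided that k - h is not in 2 pi i Z.\<close>

lemma Delta_split:
  assumes "exp u = 1" "exp h \<noteq> 1"
  shows "Delta u = Delta0 (u - h) + Delta0 h"
proof -
  have split: "Delta0 (u - h) + Delta0 h = Delta0 (u - k) + Delta0 k"
    if "exp h \<noteq> 1" "exp k \<noteq> 1" "exp (k - h) \<noteq> 1" for h k
  proof -
    have "Delta0 ((u - k) + (k - h)) = Delta0 (u - k) + Delta0 (k - h)"
      using that assms(1) by (intro Delta0_add) (auto simp: exp_diff exp_add)
    moreover have "Delta0 ((k - h) + h) = Delta0 (k - h) + Delta0 h"
      using that by (intro Delta0_add) auto
    ultimately show ?thesis by (simp add: algebra_simps)
  qed
  have "Delta0 (u - h) + Delta0 h = Delta0 (u - 1) + Delta0 1"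
  proof (cases "exp (1 - h) = 1")
    case False
    then show ?thesis using split[of h 1] assms by simp
  next
    \<comment> \<open>If h is congruent to 1, the comparison is made through the intermediate value
      2.\<close>
    case True
    then have h: "exp h = exp 1" by (simp add: exp_diff)
    have "exp (2 - h) = exp 1" unfolding exp_diff h by (simp flip: exp_diff)
    then have "Delta0 (u - h) + Delta0 h = Delta0 (u - 2) + Delta0 2"
      using assms by (intro split) auto
    also have "\<dots> = Delta0 (u - 1) + Delta0 1"
      by (rule split) auto
    finally show ?thesis .
  qed
  then show ?thesis using assms(1) by (simp add: Delta_def)
qed

text \<open>Splitting 0 as -2 + 2 and expanding both parts gives twice the splitting -1 + 1.\<close>

lemma Delta_0: "Delta 0 = 0"
proof -
  have "Delta0 1 + Delta0 1 = Delta0 2" using Delta0_add[of 1 1] by simp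
  moreover have "Delta0 (- 1) + Delta0 (- 1) = Delta0 (- 2)" using Delta0_add[of "-1" "-1"] by (simp add: exp_minus)
  moreover have "Delta 0 = Delta0 (- 1) + Delta0 1" "Delta 0 = Delta0 (- 2) + Delta0 2"
    using Delta_split[of 0 1] Delta_split[of 0 2] by simp_all
  moreover have "(Delta0 (- 1) + Delta0 1) + (Delta0 (- 1) + Delta0 1) = (Delta0 (- 1) + Delta0 (- 1)) + (Delta0 1 + Delta0 1)"
    by (simp add: algebra_simps)
  ultimately have "Delta 0 + Delta 0 = Delta 0" by metis
  then show ?thesis by simp
qed

lemma Delta0_uminus: "exp u \<noteq> 1 \<Longrightarrow> Delta0 (- u) = - Delta0 u"
  using Delta_split[of 0 u] Delta_0 by (simp add: eq_neg_iff_add_eq_0)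

lemma Delta_add: "Delta (s + t) = Delta s + Delta t"
proof -
  have mixed: "Delta (s + t) = Delta s + Delta t" if "exp s = 1" "exp t \<noteq> 1" for s t
  proof -
    have "Delta s = Delta0 (s + t) + Delta0 (- t)"
      using Delta_split[of s "- t"] that by (simp add: exp_minus)
    then show ?thesis using that Delta0_uminus[OF that(2)] by (simp add: Delta_def exp_add)
  qed
  show ?thesis
  proof (cases "exp s = 1"; cases "exp t = 1")
    \<comment> \<open>Taking 1 away from s leaves a summand outside 2 pi i Z, to which
      \<open>mixed\<close> applies.\<close>
    assume st: "exp s = 1" "exp t = 1"
    then have "Delta (s + t) = Delta0 (t + (s - 1)) + Delta0 1"
      by (simp add: Delta_def exp_add algebra_simps)
    also have "Delta0 (t + (s - 1)) = Delta (t + (s - 1))"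
      using st by (simp add: Delta_def exp_add exp_diff)
    also have "\<dots> = Delta t + Delta (s - 1)" using st by (intro mixed) (auto simp: exp_diff)
    finally show ?thesis using st by (simp add: Delta_def exp_diff algebra_simps)
  next
    assume "exp s \<noteq> 1" "exp t \<noteq> 1"
    then show ?thesis using Delta_split[of "s + t" t] Delta0_add[of s t] by (auto simp: Delta_def)
  next
    assume "exp s = 1" "exp t \<noteq> 1" then show ?thesis by (rule mixed)
  next
    assume "exp s \<noteq> 1" "exp t = 1" then show ?thesis using mixed[of t s] by (simp add: add.commute)
  qed
qed

lemma Delta_minus: "Delta (- s) = - Delta s"
  using Delta_add[of s "- s"] Delta_0 by (simp add: eq_neg_iff_add_eq_0 add.commute)

lemma Delta_diff: "Delta (s - t) = Delta s - Delta t"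
  using Delta_add[of s "- t"] by (simp add: Delta_minus)

section \<open>Shifts of both logarithms\<close>

lemma Delta_eq: "exp u + exp v = 1 \<Longrightarrow> \<phi> u (v - 2 * pi * \<i>) - \<phi> u v = Delta u"
  using Delta0_eq[of u v] exp_not_eq_zero[of v] by (auto simp: Delta_def)

lemma Delta_eq': "exp u + exp v = 1 \<Longrightarrow> \<phi> u (v + 2 * pi * \<i>) - \<phi> u v = - Delta u"
  using Delta_eq[of u "v + 2 * pi * \<i>"] minus_diff_eq[of "\<phi> u v" "\<phi> u (v + 2 * pi * \<i>)"]
  by (simp only: exp_shift_2pi_i add_diff_cancel_right')

text \<open>Shifting a and c together fixes c - a, so besides the first two terms only the fifth
  changes, by Delta d - Delta b. Hence the defect is the same at any two points with distinct x and
  y.\<close>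

lemma shift_first_const:
  obtains \<epsilon> where "\<And>a b. exp a + exp b = 1 \<Longrightarrow> \<phi> (a + 2 * pi * \<i>) b - \<phi> a b = Delta b + \<epsilon>"
proof -
  have ne: "\<phi> (a + 2 * pi * \<i>) b - \<phi> a b - Delta b = \<phi> (c + 2 * pi * \<i>) d - \<phi> c d - Delta d"
    if ab: "exp a + exp b = 1" and cd: "exp c + exp d = 1" and ac: "exp a \<noteq> exp c" for a b c d
  proof -
    define e where "e = Ln (1 - exp (c - a))"
    have e: "exp (c - a) + exp e = 1" using ac by (simp add: e_def exp_diff)
    have 1: "exp (a + 2 * pi * \<i>) + exp b = 1" "exp (c + 2 * pi * \<i>) + exp d = 1"
      using ab cd by (simp_all only: exp_shift_2pi_i)
    have "exp (c + 2 * pi * \<i> - (a + 2 * pi * \<i>)) + exp e = 1" using e by simp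
    from five_term[OF 1 this]
    have "\<phi> (a + 2 * pi * \<i>) b - \<phi> (c + 2 * pi * \<i>) d + \<phi> (c - a) e - \<phi> (c - a + b - d) (e - d)
       + \<phi> (b - d) (e - d + a + 2 * pi * \<i>) = 0"
      by (simp add: add.assoc)
    moreover have "\<phi> (b - d) (e - d + a + 2 * pi * \<i>) - \<phi> (b - d) (e - d + a) = Delta d - Delta b"
      using Delta_eq'[OF five_term_curves(1)[OF ab cd e]] by (simp add: Delta_diff)
    moreover have "p' - p - s = q' - q - t"
      if "p' - q' + x - y + z' = 0" "p - q + x - y + z = 0" "z' - z = t - s" for p p' q q' x y z z' s t :: 'g
    proof -
      have "(p' - p - s) - (q' - q - t) = ((p' - q' + x - y + z') - (p - q + x - y + z)) - (z' - z) + (t - s)"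
        by (simp add: algebra_simps)
      then show ?thesis using that by simp
    qed
    ultimately show ?thesis using five_term[OF ab cd e] by blast
  qed
  \<comment> \<open>Two reference points, z = 1/2 and z = 1/3; a point over 1/2 is compared with the
    first through the second.\<close>
  define a0 where "a0 = Ln (1 / 2)"
  define a1 where "a1 = Ln (1 / 3)"
  define b1 where "b1 = Ln (2 / 3)"
  have 0: "exp a0 + exp a0 = 1" "exp a1 + exp b1 = 1" "exp a0 \<noteq> exp a1" by (simp_all add: a0_def a1_def b1_def)
  define \<epsilon> where "\<epsilon> = \<phi> (a0 + 2 * pi * \<i>) a0 - \<phi> a0 a0 - Delta a0"
  have "\<phi> (a + 2 * pi * \<i>) b - \<phi> a b - Delta b = \<epsilon>" if ab: "exp a + exp b = 1" for a b
  proof (cases "exp a = exp a0")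
    case True
    then show ?thesis using ne[OF ab 0(2)] ne[OF 0(1,2,3)] 0(3) unfolding \<epsilon>_def by simp
  next
    case False
    then show ?thesis using ne[OF ab 0(1)] unfolding \<epsilon>_def by simp
  qed
  then show thesis using that[of \<epsilon>] by (simp add: algebra_simps)
qed

text \<open>Shifting a alone changes the first, third, fourth and fifth terms. The values of
  \<open>Delta\<close> cancel by additivity, and the defect enters with total coefficient 1 - 1 + 1,
  so it vanishes.\<close>

lemma shift_first:
  assumes "exp a + exp b = 1"
  shows "\<phi> (a + 2 * pi * \<i>) b - \<phi> a b = Delta b"
proof -
  obtain \<epsilon> where \<epsilon>: "\<And>a b. exp a + exp b = 1 \<Longrightarrow> \<phi> (a + 2 * pi * \<i>) b - \<phi> a b = Delta b + \<epsilon>"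
    using shift_first_const by blast
  obtain c where c: "exp c \<noteq> 1" "exp c \<noteq> exp a"
  proof (cases "exp a = 2")
    case True then show ?thesis using that[of "Ln 3"] by simp
  next
    case False then show ?thesis using that[of "Ln 2"] by simp
  qed
  define d where "d = Ln (1 - exp c)"
  have cd: "exp c + exp d = 1" using c by (simp add: d_def)
  define e where "e = Ln (1 - exp (c - a))"
  have e: "exp (c - a) + exp e = 1" using c by (simp add: e_def exp_diff)
  note curves = five_term_curves[OF assms cd e]
  have 1: "exp (a + 2 * pi * \<i>) + exp b = 1" using assms by (simp only: exp_shift_2pi_i)
  have "exp (c - (a + 2 * pi * \<i>)) + exp e = 1"
    using e exp_shift_2pi_i(1)[of "c - a"] by (simp add: diff_diff_eq)
  from five_term[OF 1 cd this]
  have "\<phi> (a + 2 * pi * \<i>) b - \<phi> c d + \<phi> (c - a - 2 * pi * \<i>) e - \<phi> (c - a + b - d - 2 * pi * \<i>) (e - d)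
      + \<phi> (b - d) (e - d + a + 2 * pi * \<i>) = 0"
    by (simp add: algebra_simps)
  moreover have "\<phi> (c - a) e - \<phi> (c - a - 2 * pi * \<i>) e = Delta e + \<epsilon>"
  proof -
    have "exp (c - a - 2 * pi * \<i>) + exp e = 1" using e by (simp only: exp_shift_2pi_i)
    from \<epsilon>[OF this] show ?thesis by (simp only: diff_add_cancel)
  qed
  moreover have "\<phi> (c - a + b - d) (e - d) - \<phi> (c - a + b - d - 2 * pi * \<i>) (e - d) = Delta (e - d) + \<epsilon>"
  proof -
    have "exp (c - a + b - d - 2 * pi * \<i>) + exp (e - d) = 1" using curves(2) by (simp only: exp_shift_2pi_i)
    from \<epsilon>[OF this] show ?thesis by (simp only: diff_add_cancel)
  qed
  moreover have "\<phi> (b - d) (e - d + a + 2 * pi * \<i>) - \<phi> (b - d) (e - d + a) = - Delta (b - d)"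
    by (rule Delta_eq'[OF curves(1)])
  moreover have "\<epsilon> = 0"
    if "p' - q + x' - y' + z' = 0" "x - x' = t + \<epsilon>" "y - y' = (t - r) + \<epsilon>" "z' - z = - (s - r)"
      "p - q + x - y + z = 0" "p' - p = s + \<epsilon>" for p p' q x x' y y' z z' r s t :: 'g
  proof -
    have "(p' - q + x' - y' + z') - (p - q + x - y + z) = (p' - p) - (x - x') + (y - y') + (z' - z)"
      by (simp add: algebra_simps)
    then show ?thesis unfolding that by simp
  qed
  ultimately have "\<epsilon> = 0" using five_term[OF assms cd e] \<epsilon>[OF assms] unfolding Delta_diff by blast
  then show ?thesis using \<epsilon>[OF assms] by simp
qed

text \<open>At z = 1/2 one u serves as logarithm of both z and 1 - z. Performing the two shifts in
  either order gives Delta (u + 2 pi i) = Delta (u - 2 pi i).\<close>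

lemma Delta_4pi_i: "Delta (2 * pi * \<i>) + Delta (2 * pi * \<i>) = 0"
proof -
  define u where "u = Ln (1 / 2)"
  have u: "exp u + exp u = 1" by (simp add: u_def)
  have u1: "exp (u + 2 * pi * \<i>) + exp u = 1" and u2: "exp u + exp (u - 2 * pi * \<i>) = 1"
    using u by (simp_all only: exp_shift_2pi_i)
  have "\<phi> (u + 2 * pi * \<i>) (u - 2 * pi * \<i>) - \<phi> u u = Delta (u + 2 * pi * \<i>) + Delta u"
    using Delta_eq[OF u1] shift_first[OF u] by (simp add: algebra_simps)
  moreover have "\<phi> (u + 2 * pi * \<i>) (u - 2 * pi * \<i>) - \<phi> u u = Delta (u - 2 * pi * \<i>) + Delta u"
    using Delta_eq[OF u] shift_first[OF u2] by (simp add: algebra_simps)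
  ultimately show ?thesis by (simp add: Delta_add Delta_diff eq_neg_iff_add_eq_0)
qed

lemma Delta_period: "Delta (u + 4 * pi * \<i> * of_int n) = Delta u"
proof -
  have "4 * pi * \<i> = 2 * pi * \<i> + 2 * pi * \<i>" by simp
  then have 4: "Delta (4 * pi * \<i>) = 0" using Delta_4pi_i Delta_add by metis
  have nat: "Delta (4 * pi * \<i> * of_nat m) = 0" for m
    by (induction m) (simp_all add: Delta_0 distrib_left Delta_add 4[simplified])
  have "Delta (4 * pi * \<i> * of_int n) = 0"
  proof (cases "n \<ge> 0")
    case True then show ?thesis using nat[of "nat n"] by simp
  next
    case False
    then show ?thesis using nat[of "nat (- n)"] Delta_minus[of "4 * pi * \<i> * of_int n"] by simp
  qed
  then show ?thesis by (simp only: Delta_add add_0_right)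
qed

text \<open>Any two lifts of z are linked by repeated single shifts, first of v and then of u, each
  contributing a value of \<open>Delta\<close>.\<close>

lemma Delta_range:
  assumes uv: "exp u + exp v = 1" and "exp u' = exp u" "exp v' = exp v"
  obtains w where "\<phi> u' v' - \<phi> u v = Delta w"
proof -
  have lift: "\<exists>n. x = y + 2 * pi * \<i> * of_int n" if xy: "exp x = exp y" for x y :: complex
  proof -
    obtain n where "x = y + (of_int (2 * n) * pi) * \<i>" using xy unfolding exp_eq by blast
    then show ?thesis by (intro exI[of _ n]) simp
  qed
  have e: "exp (x + 2 * pi * \<i> * of_nat m) = exp x" "exp (x - 2 * pi * \<i> * of_nat m) = exp x" for x m
    using exp_integer_2pi[of "of_nat m"] by (simp_all add: exp_add exp_diff mult_ac)
  have v_nat: "\<phi> u (v - 2 * pi * \<i> * of_nat m) - \<phi> u v = Delta (of_nat m * u)" if "exp u + exp v = 1" for u v m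
  proof (induction m)
    case (Suc m)
    have "\<phi> u (v - 2 * pi * \<i> * of_nat m - 2 * pi * \<i>) - \<phi> u (v - 2 * pi * \<i> * of_nat m) = Delta u"
      using that by (intro Delta_eq) (simp only: e)
    with Suc show ?case by (simp add: distrib_right distrib_left Delta_add algebra_simps)
  qed (simp add: Delta_0)
  have u_nat: "\<phi> (u + 2 * pi * \<i> * of_nat m) v - \<phi> u v = Delta (of_nat m * v)" if "exp u + exp v = 1" for u v m
  proof (induction m)
    case (Suc m)
    have "\<phi> (u + 2 * pi * \<i> * of_nat m + 2 * pi * \<i>) v - \<phi> (u + 2 * pi * \<i> * of_nat m) v = Delta v"
      using that by (intro shift_first) (simp only: e)
    with Suc show ?case by (simp add: distrib_right distrib_left Delta_add algebra_simps)
  qed (simp add: Delta_0)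
  have v_part: "\<exists>w. \<phi> u v' - \<phi> u v = Delta w" if uv: "exp u + exp v = 1" and "exp v' = exp v" for u v v'
  proof -
    obtain n where n: "v' = v + 2 * pi * \<i> * of_int n" using lift \<open>exp v' = exp v\<close> by blast
    show ?thesis
    proof (cases "n \<ge> 0")
      case True
      then have "\<phi> u v - \<phi> u v' = Delta (of_nat (nat n) * u)"
        using v_nat[of u v' "nat n"] that by (simp add: n)
      then show ?thesis by (metis Delta_minus minus_diff_eq)
    next
      case False
      then have "\<phi> u v' - \<phi> u v = Delta (of_nat (nat (- n)) * u)"
        using v_nat[of u v "nat (- n)"] that by (simp add: n)
      then show ?thesis by blast
    qed
  qed
  have u_part: "\<exists>w. \<phi> u' v - \<phi> u v = Delta w" if uv: "exp u + exp v = 1" and "exp u' = exp u" for u u' v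
  proof -
    obtain n where n: "u' = u + 2 * pi * \<i> * of_int n" using lift \<open>exp u' = exp u\<close> by blast
    show ?thesis
    proof (cases "n \<ge> 0")
      case True
      then have "\<phi> u' v - \<phi> u v = Delta (of_nat (nat n) * v)"
        using u_nat[of u v "nat n"] that by (simp add: n)
      then show ?thesis by blast
    next
      case False
      then have "\<phi> u v - \<phi> u' v = Delta (of_nat (nat (- n)) * v)"
        using u_nat[of u' v "nat (- n)"] that by (simp add: n)
      then show ?thesis by (metis Delta_minus minus_diff_eq)
    qed
  qed
  obtain w1 where w1: "\<phi> u v' - \<phi> u v = Delta w1" using v_part[OF uv assms(3)] by blast
  obtain w2 where w2: "\<phi> u' v' - \<phi> u v' = Delta w2" using u_part[of u v' u'] assms by auto
  have "\<phi> u' v' - \<phi> u v = (\<phi> u' v' - \<phi> u v') + (\<phi> u v' - \<phi> u v)" by simp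
  also have "\<dots> = Delta (w2 + w1)" unfolding w1 w2 Delta_add ..
  finally show thesis by (rule that)
qed

section \<open>The homomorphism on nonzero complex numbers\<close>

definition chi :: "complex \<Rightarrow> 'g" where
  "chi z = Delta (2 * Ln z)"

text \<open>Another logarithm changes \<open>2 * Ln z\<close> by a multiple of 4 pi i, a period of
  \<open>Delta\<close>; so the branch is immaterial.\<close>

lemma chi_exp: "chi (exp (w / 2)) = Delta w"
proof -
  have "exp (Ln (exp (w / 2))) = exp (w / 2)" by simp
  then obtain n where "Ln (exp (w / 2)) = w / 2 + (of_int (2 * n) * pi) * \<i>" unfolding exp_eq by blast
  then have "2 * Ln (exp (w / 2)) = w + 4 * pi * \<i> * of_int n" by simp
  then show ?thesis unfolding chi_def using Delta_period by metis
qed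

lemma chi_mult:
  assumes "z \<noteq> 0" "w \<noteq> 0"
  shows "chi (z * w) = chi z + chi w"
proof -
  have "z * w = exp ((2 * Ln z + 2 * Ln w) / 2)" using assms by (simp add: add_divide_distrib exp_add)
  then have "chi (z * w) = Delta (2 * Ln z + 2 * Ln w)" using chi_exp by metis
  then show ?thesis by (simp add: chi_def Delta_add)
qed

end


section \<open>The extended pre-Bloch group\<close>

text \<open>Stated for all x and y, also outside the carrier, since the coset operation is addition
  on the whole type; this matches the relation of the quotient type below.\<close>

lemma free_Abelian_group_rcoset_eq_iff:
  assumes "subgroup H (free_Abelian_group S)"
  shows "H #>\<^bsub>free_Abelian_group S\<^esub> x = H #>\<^bsub>free_Abelian_group S\<^esub> y \<longleftrightarrow> x - y \<in> H"
proof -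
  have z: "0 \<in> H" using subgroup.one_closed[OF assms] by simp
  have add: "a + b \<in> H" if "a \<in> H" "b \<in> H" for a b
    using subgroup.m_closed[OF assms that] by simp
  have keys: "Poly_Mapping.keys a \<subseteq> S" if "a \<in> H" for a
    using subgroup.mem_carrier[OF assms that] by simp
  have neg: "- a \<in> H" if "a \<in> H" for a
    using subgroup.m_inv_closed[OF assms that] keys[OF that] by simp
  have sub: "H #>\<^bsub>free_Abelian_group S\<^esub> x \<subseteq> H #>\<^bsub>free_Abelian_group S\<^esub> y" if "x - y \<in> H" for x y
  proof
    fix u assume "u \<in> H #>\<^bsub>free_Abelian_group S\<^esub> x"
    then obtain h where "h \<in> H" "u = h + x" by (auto simp: r_coset_def)
    then show "u \<in> H #>\<^bsub>free_Abelian_group S\<^esub> y"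
      using add[of h "x - y"] that by (auto simp: r_coset_def intro!: bexI[of _ "h + (x - y)"])
  qed
  show ?thesis
  proof
    assume "H #>\<^bsub>free_Abelian_group S\<^esub> x = H #>\<^bsub>free_Abelian_group S\<^esub> y"
    moreover have "x \<in> H #>\<^bsub>free_Abelian_group S\<^esub> x" using z by (auto simp: r_coset_def intro!: bexI[of _ 0])
    ultimately obtain h where "h \<in> H" "x = h + y" by (auto simp: r_coset_def)
    then show "x - y \<in> H" by simp
  next
    assume "x - y \<in> H"
    moreover from this have "y - x \<in> H" using neg by fastforce
    ultimately show "H #>\<^bsub>free_Abelian_group S\<^esub> x = H #>\<^bsub>free_Abelian_group S\<^esub> y"
      using sub by blast
  qed
qed

lemma FT_hat_subset_FT_lift: "FT_hat \<subseteq> FT_lift"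
  unfolding FT_hat_def using connected_component_subset by blast

section \<open>The two quotient groups\<close>

lemma group_Zhat [simp]: "group Zhat" and group_ZP [simp]: "group ZP"
  by (simp_all add: Zhat_def ZP_def)

lemma carrier_Zhat: "x \<in> carrier Zhat \<longleftrightarrow> Poly_Mapping.keys x \<subseteq> Chat"
  and carrier_ZP: "y \<in> carrier ZP \<longleftrightarrow> Poly_Mapping.keys y \<subseteq> UNIV - {0, 1}"
  by (simp_all add: Zhat_def ZP_def)

lemma Zhat_mult [simp]: "x \<otimes>\<^bsub>Zhat\<^esub> y = x + y" and ZP_mult [simp]: "u \<otimes>\<^bsub>ZP\<^esub> v = u + v"
  and Zhat_one [simp]: "\<one>\<^bsub>Zhat\<^esub> = 0" and ZP_one [simp]: "\<one>\<^bsub>ZP\<^esub> = 0"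
  by (simp_all add: Zhat_def ZP_def)

lemma frag_of_Zhat: "frag_of u \<in> carrier Zhat \<longleftrightarrow> u \<in> Chat"
  and frag_of_ZP: "frag_of z \<in> carrier ZP \<longleftrightarrow> z \<notin> {0, 1}"
  by (simp_all add: carrier_Zhat carrier_ZP keys_frag_of)

lemma Zhat_add: "x \<in> carrier Zhat \<Longrightarrow> y \<in> carrier Zhat \<Longrightarrow> x + y \<in> carrier Zhat"
  and Zhat_diff: "x \<in> carrier Zhat \<Longrightarrow> y \<in> carrier Zhat \<Longrightarrow> x - y \<in> carrier Zhat"
  and ZP_add: "u \<in> carrier ZP \<Longrightarrow> v \<in> carrier ZP \<Longrightarrow> u + v \<in> carrier ZP"
  and ZP_diff: "u \<in> carrier ZP \<Longrightarrow> v \<in> carrier ZP \<Longrightarrow> u - v \<in> carrier ZP"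
  unfolding carrier_Zhat carrier_ZP
  using Poly_Mapping.keys_add[of x y] keys_diff[of x y] Poly_Mapping.keys_add[of u v] keys_diff[of u v] by blast+

lemma five_term_Zhat: "w \<in> FT_lift \<Longrightarrow> five_term w \<in> carrier Zhat"
  unfolding five_term_def by (intro Zhat_add Zhat_diff) (auto simp: frag_of_Zhat FT_lift_def)

lemma five_term_ZP: "v \<in> FT \<Longrightarrow> five_term v \<in> carrier ZP"
  unfolding five_term_def
  by (intro ZP_add ZP_diff) (auto simp: frag_of_ZP FT_def divide_eq_eq)

lemma subgroup_Rhat: "subgroup Rhat Zhat"
  unfolding Rhat_def using five_term_Zhat FT_hat_subset_FT_lift
  by (intro group.generate_is_subgroup) auto

lemma subgroup_RP: "subgroup RP ZP"
  unfolding RP_def using five_term_ZP by (intro group.generate_is_subgroup) auto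

lemma normal_Rhat: "Rhat \<lhd> Zhat" and normal_RP: "RP \<lhd> ZP"
  using subgroup_Rhat subgroup_RP
  by (auto simp: Zhat_def ZP_def intro!: comm_group.normal_iff_subgroup[THEN iffD2] abelian_free_Abelian_group)

lemma Rhat_coset_eq: "Rhat #>\<^bsub>Zhat\<^esub> x = Rhat #>\<^bsub>Zhat\<^esub> y \<longleftrightarrow> x - y \<in> Rhat"
  and RP_coset_eq: "RP #>\<^bsub>ZP\<^esub> u = RP #>\<^bsub>ZP\<^esub> v \<longleftrightarrow> u - v \<in> RP"
  using free_Abelian_group_rcoset_eq_iff subgroup_Rhat subgroup_RP unfolding Zhat_def ZP_def by blast+

lemma Rhat_0: "0 \<in> Rhat"
  using subgroup.one_closed[OF subgroup_Rhat] by simp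

lemma Rhat_add: "x \<in> Rhat \<Longrightarrow> y \<in> Rhat \<Longrightarrow> x + y \<in> Rhat"
  using subgroup.m_closed[OF subgroup_Rhat, of x y] by simp

lemma Rhat_carrier: "x \<in> Rhat \<Longrightarrow> x \<in> carrier Zhat"
  using subgroup.mem_carrier[OF subgroup_Rhat] .

lemma Rhat_uminus: "x \<in> Rhat \<Longrightarrow> - x \<in> Rhat"
  using subgroup.m_inv_closed[OF subgroup_Rhat, of x] Rhat_carrier[of x] by (simp add: carrier_Zhat) (simp add: Zhat_def)

lemma carrier_Phat: "carrier Phat = (\<lambda>x. Rhat #>\<^bsub>Zhat\<^esub> x) ` carrier Zhat"
  and carrier_PB: "carrier PB = (\<lambda>x. RP #>\<^bsub>ZP\<^esub> x) ` carrier ZP"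
  by (auto simp: Phat_def PB_def FactGroup_def RCOSETS_def)

lemma Phat_mult: "x \<in> carrier Zhat \<Longrightarrow> y \<in> carrier Zhat \<Longrightarrow>
    (Rhat #>\<^bsub>Zhat\<^esub> x) \<otimes>\<^bsub>Phat\<^esub> (Rhat #>\<^bsub>Zhat\<^esub> y) = Rhat #>\<^bsub>Zhat\<^esub> (x + y)"
  using normal.rcos_sum[OF normal_Rhat, of x y] by (simp add: Phat_def FactGroup_def)

lemma PB_mult: "x \<in> carrier ZP \<Longrightarrow> y \<in> carrier ZP \<Longrightarrow>
    (RP #>\<^bsub>ZP\<^esub> x) \<otimes>\<^bsub>PB\<^esub> (RP #>\<^bsub>ZP\<^esub> y) = RP #>\<^bsub>ZP\<^esub> (x + y)"
  using normal.rcos_sum[OF normal_RP, of x y] by (simp add: PB_def FactGroup_def)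

lemma PB_one: "\<one>\<^bsub>PB\<^esub> = RP #>\<^bsub>ZP\<^esub> 0"
  by (simp add: PB_def FactGroup_def r_coset_def)

lemma comm_group_Phat: "comm_group Phat" and group_PB: "group PB"
proof -
  have "comm_group Zhat" by (simp add: Zhat_def abelian_free_Abelian_group)
  then show "comm_group Phat" unfolding Phat_def by (rule comm_group.abelian_FactGroup[OF _ subgroup_Rhat])
  show "group PB" unfolding PB_def by (rule normal.factorgroup_is_group[OF normal_RP])
qed

lemma comm_group_Cx: "comm_group Cx"
  by (rule comm_groupI) (auto simp: Cx_def intro!: exI[of _ "inverse _"] bexI[of _ "inverse _"])

text \<open>A type-class version of \<open>Phat\<close>, for algebra with the simplifier; unlike \<open>Phat\<close> it also contains
  classes of elements outside \<open>carrier Zhat\<close>.\<close>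
quotient_type ext_pre_bloch = "(complex \<times> complex) \<Rightarrow>\<^sub>0 int" / "\<lambda>x y. x - y \<in> Rhat"
  morphisms rep_ext_pre_bloch bloch_class
proof (rule equivpI)
  show "reflp (\<lambda>x y. x - y \<in> Rhat)" by (simp add: reflp_def Rhat_0)
  show "symp (\<lambda>x y. x - y \<in> Rhat)" using Rhat_uminus by (intro sympI) (metis minus_diff_eq)
  show "transp (\<lambda>x y. x - y \<in> Rhat)"
  proof (rule transpI)
    fix x y z assume "x - y \<in> Rhat" "y - z \<in> Rhat"
    then show "x - z \<in> Rhat" using Rhat_add[of "x - y" "y - z"] by simp
  qed
qed

instantiation ext_pre_bloch :: ab_group_add
begin

lift_definition zero_ext_pre_bloch :: ext_pre_bloch is 0 .

lift_definition plus_ext_pre_bloch :: "ext_pre_bloch \<Rightarrow> ext_pre_bloch \<Rightarrow> ext_pre_bloch" is "(+)"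
proof -
  fix x x' y y' assume "x - x' \<in> Rhat" "y - y' \<in> Rhat"
  then show "x + y - (x' + y') \<in> Rhat" using Rhat_add[of "x - x'" "y - y'"] by (simp add: algebra_simps)
qed

lift_definition uminus_ext_pre_bloch :: "ext_pre_bloch \<Rightarrow> ext_pre_bloch" is uminus
proof -
  fix x x' assume "x - x' \<in> Rhat"
  then show "- x - - x' \<in> Rhat" using Rhat_uminus[of "x - x'"] by simp
qed

lift_definition minus_ext_pre_bloch :: "ext_pre_bloch \<Rightarrow> ext_pre_bloch \<Rightarrow> ext_pre_bloch" is "(-)"
proof -
  fix x x' y y' assume "x - x' \<in> Rhat" "y - y' \<in> Rhat"
  then show "x - y - (x' - y') \<in> Rhat"
    using Rhat_add[of "x - x'" "- (y - y')"] Rhat_uminus[of "y - y'"] by (simp add: algebra_simps)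
qed

instance
  by standard (transfer, simp add: Rhat_0 algebra_simps)+

end

lemma bloch_class_eq_iff: "bloch_class x = bloch_class y \<longleftrightarrow> x - y \<in> Rhat"
  by (rule ext_pre_bloch.abs_eq_iff)

lemma bloch_class_simps:
  "bloch_class 0 = 0" "bloch_class (x + y) = bloch_class x + bloch_class y"
  "bloch_class (- x) = - bloch_class x" "bloch_class (x - y) = bloch_class x - bloch_class y"
  by (simp_all add: zero_ext_pre_bloch.abs_eq plus_ext_pre_bloch.abs_eq uminus_ext_pre_bloch.abs_eq minus_ext_pre_bloch.abs_eq)

lemma FT_hat_vector:
  assumes "exp a + exp b = 1" "exp c + exp d = 1" "exp (c - a) + exp e = 1"
  shows "vector [(a, b), (c, d), (c - a, e), (c - a + b - d, e - d), (b - d, e - d + a)] \<in> FT_hat"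
proof -
  \<comment> \<open>\<open>FT_point\<close> expects a logarithm of x - y, whereas e is one of 1 -
    y/x; hence e + a.\<close>
  define w :: "complex ^ 5" where "w = vector [a, b, c, d, e + a]"
  have b: "exp b = 1 - exp a" and d: "exp d = 1 - exp c" using assms by (simp_all add: eq_diff_eq add.commute)
  have "exp e = 1 - exp c / exp a" using assms(3) by (simp add: eq_diff_eq add.commute exp_diff)
  then have ea: "exp (e + a) = exp a - exp c" by (simp add: exp_add left_diff_distrib)
  have "((exp a, exp c), w) \<in> FT_cover"
    unfolding FT_cover_iff w_def vector_5 b[symmetric] d[symmetric] ea[symmetric]
    using b d ea exp_not_eq_zero[of b] exp_not_eq_zero[of d] exp_not_eq_zero[of "e + a"] by auto
  moreover have "FT_point w = vector [(a, b), (c, d), (c - a, e), (c - a + b - d, e - d), (b - d, e - d + a)]"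
    by (simp add: FT_point_def w_def algebra_simps)
  ultimately show ?thesis unfolding FT_hat_eq by force
qed

interpretation P: five_term_function "\<lambda>u v. bloch_class (frag_of (u, v))"
proof
  fix a b c d e :: complex
  assume "exp a + exp b = 1" "exp c + exp d = 1" "exp (c - a) + exp e = 1"
  from FT_hat_vector[OF this]
  have "five_term (vector [(a, b), (c, d), (c - a, e), (c - a + b - d, e - d), (b - d, e - d + a)]) \<in> Rhat"
    unfolding Rhat_def by (intro generate.incl imageI)
  then have "bloch_class (five_term (vector [(a, b), (c, d), (c - a, e), (c - a + b - d, e - d), (b - d, e - d + a)])) = bloch_class 0"
    by (simp add: bloch_class_eq_iff)
  then show "bloch_class (frag_of (a, b)) - bloch_class (frag_of (c, d)) + bloch_class (frag_of (c - a, e)) -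
      bloch_class (frag_of (c - a + b - d, e - d)) + bloch_class (frag_of (b - d, e - d + a)) = 0"
    by (simp add: five_term_def bloch_class_simps)
qed


section \<open>Exactness and splitting\<close>

lemma pihat_free_simps [simp]:
  "pihat_free 0 = 0" "pihat_free (frag_of u) = frag_of (pihat u)"
  "pihat_free (x + y) = pihat_free x + pihat_free y" "pihat_free (x - y) = pihat_free x - pihat_free y"
  "pihat_free (- x) = - pihat_free x"
  by (simp_all add: pihat_free_def frag_extend_add frag_extend_diff frag_extend_minus)

lemma pihat_Chat: "u \<in> Chat \<Longrightarrow> pihat u \<notin> {0, 1}"
  using exp_not_eq_zero[of "snd u"] by (auto simp: Chat_iff pihat_def)

lemma pihat_free_ZP: "x \<in> carrier Zhat \<Longrightarrow> pihat_free x \<in> carrier ZP"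
  using keys_frag_extend[of "\<lambda>u. frag_of (pihat u)" x] pihat_Chat
  unfolding carrier_Zhat carrier_ZP pihat_free_def by (fastforce simp: keys_frag_of)

lemma pihat_free_five_term: "pihat_free (five_term w) = five_term (\<chi> i. pihat (w $ i))"
  by (simp add: five_term_def)

lemma RP_uminus: "y \<in> RP \<Longrightarrow> - y \<in> RP"
  using subgroup.m_inv_closed[OF subgroup_RP, of y] subgroup.mem_carrier[OF subgroup_RP, of y]
  by (simp add: carrier_ZP) (simp add: ZP_def)

lemma RP_add: "x \<in> RP \<Longrightarrow> y \<in> RP \<Longrightarrow> x + y \<in> RP"
  using subgroup.m_closed[OF subgroup_RP, of x y] by simp

lemma RP_0: "0 \<in> RP"
  using subgroup.one_closed[OF subgroup_RP] by simp

lemma inv_Zhat: "x \<in> carrier Zhat \<Longrightarrow> inv\<^bsub>Zhat\<^esub> x = - x"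
  unfolding carrier_Zhat by (simp add: Zhat_def)

lemma inv_ZP: "x \<in> carrier ZP \<Longrightarrow> inv\<^bsub>ZP\<^esub> x = - x"
  unfolding carrier_ZP by (simp add: ZP_def)

lemma pihat_free_Rhat: "x \<in> Rhat \<Longrightarrow> pihat_free x \<in> RP"
  unfolding Rhat_def
proof (induction rule: generate.induct)
  case one then show ?case by (simp add: RP_0)
next
  case (incl h)
  then show ?case using FT_hat_subset_FT_lift
    by (auto simp: pihat_free_five_term RP_def FT_lift_def intro!: generate.incl)
next
  case (inv h)
  then obtain w where w: "w \<in> FT_hat" "h = five_term w" by blast
  then have "pihat_free h \<in> RP" using FT_hat_subset_FT_lift
    by (auto simp: pihat_free_five_term RP_def FT_lift_def intro!: generate.incl)
  moreover have "inv\<^bsub>Zhat\<^esub> h = - h" using w five_term_Zhat FT_hat_subset_FT_lift inv_Zhat by blast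
  ultimately show ?case by (simp add: RP_uminus)
next
  case (eng h1 h2)
  then show ?case by (simp add: RP_add)
qed

text \<open>The chosen representative differs from x by an element of \<open>Rhat\<close>, whose
  image lies in \<open>RP\<close>.\<close>

lemma pihat_star_coset: "pihat_star (Rhat #>\<^bsub>Zhat\<^esub> x) = RP #>\<^bsub>ZP\<^esub> pihat_free x"
proof -
  have "x \<in> Rhat #>\<^bsub>Zhat\<^esub> x" using Rhat_0 by (auto simp: r_coset_def intro!: bexI[of _ 0])
  then have "(SOME y. y \<in> Rhat #>\<^bsub>Zhat\<^esub> x) \<in> Rhat #>\<^bsub>Zhat\<^esub> x" by (rule someI)
  then obtain h where h: "h \<in> Rhat" "(SOME y. y \<in> Rhat #>\<^bsub>Zhat\<^esub> x) = h + x" by (auto simp: r_coset_def)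
  show ?thesis unfolding pihat_star_def h(2) RP_coset_eq using pihat_free_Rhat[OF h(1)] by simp
qed

lemma pihat_star_hom: "pihat_star \<in> hom Phat PB"
proof (rule homI)
  fix X assume "X \<in> carrier Phat"
  then show "pihat_star X \<in> carrier PB"
    by (auto simp: carrier_Phat carrier_PB pihat_star_coset pihat_free_ZP)
next
  fix X Y assume "X \<in> carrier Phat" "Y \<in> carrier Phat"
  then show "pihat_star (X \<otimes>\<^bsub>Phat\<^esub> Y) = pihat_star X \<otimes>\<^bsub>PB\<^esub> pihat_star Y"
    by (auto simp: carrier_Phat Phat_mult PB_mult pihat_star_coset pihat_free_ZP)
qed

text \<open>By \<open>FT_hat_eq\<close> any logarithms of the five units give a lift, in particular
  the principal ones.\<close>

lemma FT_lifts:
  assumes "v \<in> FT"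
  obtains w where "w \<in> FT_hat" "(\<chi> i. pihat (w $ i)) = v"
proof -
  obtain x y where v: "v = vector [x, y, y / x, (1 - 1 / x) / (1 - 1 / y), (1 - x) / (1 - y)]"
    and xy: "x \<noteq> y" "x \<noteq> 0" "x \<noteq> 1" "y \<noteq> 0" "y \<noteq> 1"
    using assms by (auto simp: FT_def)
  define w :: "complex ^ 5" where "w = vector [Ln x, Ln (1 - x), Ln y, Ln (1 - y), Ln (x - y)]"
  have "((x, y), w) \<in> FT_cover" using xy by (simp add: FT_cover_iff w_def)
  then have "FT_point w \<in> FT_hat" unfolding FT_hat_eq by force
  moreover have "(\<chi> i. pihat (FT_point w $ i)) = v"
    using xy unfolding v
    by (simp add: vec_eq_iff forall_5 FT_point_def w_def pihat_def exp_diff exp_add FT_cross_ratios(1))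
  ultimately show thesis by (rule that)
qed

lemma RP_lifts: "y \<in> RP \<Longrightarrow> \<exists>x \<in> Rhat. pihat_free x = y"
  unfolding RP_def
proof (induction rule: generate.induct)
  case one then show ?case using Rhat_0 by (intro bexI[of _ 0]) auto
next
  case (incl h)
  then obtain v where "v \<in> FT" "h = five_term v" by blast
  moreover obtain w where "w \<in> FT_hat" "(\<chi> i. pihat (w $ i)) = v" using FT_lifts \<open>v \<in> FT\<close> by metis
  ultimately show ?case
    unfolding Rhat_def by (intro bexI[of _ "five_term w"]) (auto simp: pihat_free_five_term intro: generate.incl)
next
  case (inv h)
  then obtain v where v: "v \<in> FT" "h = five_term v" by blast
  obtain w where "w \<in> FT_hat" "(\<chi> i. pihat (w $ i)) = v" using FT_lifts v(1) by metis
  then have "pihat_free (five_term w) = h" "five_term w \<in> Rhat"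
    using v by (auto simp: Rhat_def pihat_free_five_term intro: generate.incl)
  moreover have "inv\<^bsub>ZP\<^esub> h = - h" using v five_term_ZP inv_ZP by blast
  ultimately show ?case using Rhat_uminus by (intro bexI[of _ "- five_term w"]) auto
next
  case (eng h1 h2)
  then show ?case using Rhat_add by (metis ZP_mult pihat_free_simps(3))
qed

section \<open>The map of the theorem in terms of \<open>P.Delta\<close>\<close>

lemma hat_Chat: "w \<in> Cbar_cut \<Longrightarrow> hat w p q \<in> Chat"
  unfolding Chat_def by blast

lemma curly_eq:
  "curly w p = frag_of (LogB w + 2 * pi * \<i> * of_int p, Log1B w - 2 * pi * \<i>) - frag_of (LogB w + 2 * pi * \<i> * of_int p, Log1B w)"
  by (simp add: curly_def hat_def)

lemma curly_curve: "w \<in> Cbar_cut \<Longrightarrow> exp (LogB w + 2 * pi * \<i> * of_int p) + exp (Log1B w) = 1"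
  using hat_Chat[of w p 0] by (simp add: Chat_iff hat_def)

lemma curly_Zhat: "w \<in> Cbar_cut \<Longrightarrow> curly w p \<in> carrier Zhat"
  unfolding curly_def by (intro Zhat_diff) (simp_all add: frag_of_Zhat hat_Chat)

lemma pihat_free_curly: "pihat_free (curly w p) = 0"
  by (simp add: curly_eq pihat_def)

lemma bloch_class_curly: "w \<in> Cbar_cut \<Longrightarrow> bloch_class (curly w p) = P.Delta (LogB w + 2 * pi * \<i> * of_int p)"
  unfolding curly_eq bloch_class_simps by (rule P.Delta_eq) (rule curly_curve)

lemma plus0i_Cbar_cut:
  assumes "z \<noteq> 0" "z \<noteq> 1"
  shows "plus0i z \<in> Cbar_cut"
proof (cases "z \<in> C_cut")
  case False
  then have "Im z = 0" and 1: "Re z \<le> 0 \<or> Re z \<ge> 1" by (auto simp: C_cut_def)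
  then have "z = complex_of_real (Re z)" by (simp add: complex_eq_iff)
  moreover from this have "Re z < 0 \<or> Re z > 1" using assms 1 by (metis less_eq_real_def of_real_0 of_real_1)
  ultimately show ?thesis using False by (auto simp: plus0i_def Cbar_cut_def)
qed (auto simp: plus0i_def Cbar_cut_def)

lemma LogB_plus0i: "LogB (plus0i z) = Ln z"
  by (simp add: plus0i_def LogB_def)

lemma half_Cbar_cut: "(1 / 2, 0) \<in> Cbar_cut"
proof -
  have "1 / 2 \<in> C_cut" by (simp add: C_cut_def)
  then show ?thesis unfolding Cbar_cut_def by blast
qed

text \<open>Outside the right half plane, 2 Ln z must be corrected by 2 pi i or -2 pi i according to
  the sign of the argument. The two corrections differ by 4 pi i, so the single index p = 1 serves
  both.\<close>

lemma Ln_square: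
  assumes "z \<noteq> 0"
  shows "- (pi / 2) < Arg z \<and> Arg z \<le> pi / 2 \<Longrightarrow> Ln (z ^ 2) = 2 * Ln z"
    and "\<not> (- (pi / 2) < Arg z \<and> Arg z \<le> pi / 2) \<Longrightarrow> \<exists>n. Ln (z ^ 2) + 2 * pi * \<i> = 2 * Ln z + 4 * pi * \<i> * of_int n"
proof -
  have e: "exp (2 * Ln z) = z ^ 2" using assms by (simp add: exp_double)
  have arg: "Arg z = Im (Ln z)" using assms by (rule Arg_eq_Im_Ln)
  have b: "- pi < Im (Ln z)" "Im (Ln z) \<le> pi" using assms mpi_less_Im_Ln Im_Ln_le_pi by auto
  show "Ln (z ^ 2) = 2 * Ln z" if "- (pi / 2) < Arg z \<and> Arg z \<le> pi / 2"
    using that e by (intro Ln_unique) (auto simp: arg)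
  assume "\<not> (- (pi / 2) < Arg z \<and> Arg z \<le> pi / 2)"
  then consider "Im (Ln z) \<le> - (pi / 2)" | "Im (Ln z) > pi / 2" by (auto simp: arg)
  then show "\<exists>n. Ln (z ^ 2) + 2 * pi * \<i> = 2 * Ln z + 4 * pi * \<i> * of_int n"
  proof cases
    case 1
    then have "Ln (z ^ 2) = 2 * Ln z + 2 * pi * \<i>"
      using b e by (intro Ln_unique) (auto simp: exp_add exp_shift_2pi_i(2)[simplified])
    then show ?thesis by (intro exI[of _ 1]) simp
  next
    case 2
    then have "Ln (z ^ 2) = 2 * Ln z - 2 * pi * \<i>"
      using b e by (intro Ln_unique) (auto simp: exp_diff exp_shift_2pi_i(1)[simplified])
    then show ?thesis by (intro exI[of _ 0]) simp
  qed
qed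

text \<open>The points 1 and -1 stand apart because their square 1 is not in
  \<open>Cbar_cut\<close>. Elsewhere the first log coordinate is 2 Ln z up to a period of
  \<open>P.Delta\<close>.\<close>

lemma chi_rep_cases:
  assumes "z \<noteq> 0"
  obtains (one) "z = 1" "chi_rep z = 0"
  | (minus_one) "z = - 1" "chi_rep z = kappa_rep"
  | (curly) w p n where "chi_rep z = curly w p" "w \<in> Cbar_cut"
      "LogB w + 2 * pi * \<i> * of_int p = 2 * Ln z + 4 * pi * \<i> * of_int n"
proof -
  consider "z = 1" | "z = - 1" | "z \<noteq> 1" "z \<noteq> - 1" by blast
  then show thesis
  proof cases
    case 1 then show ?thesis using one by (simp add: chi_rep_def)
  next
    case 2 then show ?thesis using minus_one by (simp add: chi_rep_def)
  next
    case 3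
    have w: "plus0i (z ^ 2) \<in> Cbar_cut"
      using 3 assms by (intro plus0i_Cbar_cut) (auto simp: power2_eq_1_iff)
    show ?thesis
    proof (cases "- (pi / 2) < Arg z \<and> Arg z \<le> pi / 2")
      case True
      show ?thesis
        by (rule curly[of "plus0i (z ^ 2)" 0 0]) (use True 3 w Ln_square(1)[OF assms True] in \<open>simp_all add: chi_rep_def LogB_plus0i\<close>)
    next
      case False
      obtain n where n: "Ln (z ^ 2) + 2 * pi * \<i> = 2 * Ln z + 4 * pi * \<i> * of_int n"
        using Ln_square(2)[OF assms False] by blast
      show ?thesis
        by (rule curly[of "plus0i (z ^ 2)" 1 n]) (use False 3 w n in \<open>auto simp add: chi_rep_def LogB_plus0i\<close>)
    qed
  qed
qed

lemma chi_rep_Zhat: "z \<noteq> 0 \<Longrightarrow> chi_rep z \<in> carrier Zhat"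
  by (erule chi_rep_cases)
    (auto simp: kappa_rep_def curly_Zhat half_Cbar_cut carrier_Zhat[of 0] intro!: Zhat_diff)

lemma pihat_free_chi_rep: "z \<noteq> 0 \<Longrightarrow> pihat_free (chi_rep z) = 0"
  by (erule chi_rep_cases) (auto simp: kappa_rep_def pihat_free_curly)

lemma bloch_class_chi_rep:
  assumes "z \<noteq> 0"
  shows "bloch_class (chi_rep z) = P.chi z"
  using assms
proof (cases rule: chi_rep_cases)
  case one
  then show ?thesis by (simp add: P.chi_def P.Delta_0 bloch_class_simps)
next
  case minus_one
  let ?L = "LogB (1 / 2, 0)"
  have "bloch_class (chi_rep z) = P.Delta ?L - P.Delta (?L + 2 * pi * \<i> * of_int (- 1))"
    unfolding minus_one(2) kappa_rep_def bloch_class_simps bloch_class_curly[OF half_Cbar_cut] by simp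
  also have "\<dots> = P.Delta (2 * pi * \<i>)" unfolding P.Delta_diff[symmetric] by simp
  \<comment> \<open>This identifies the class of \<open>kappa_rep\<close> with the value of
    \<open>P.chi\<close> at -1.\<close>
  also have "2 * pi * \<i> = 2 * Ln (- 1)" by simp
  finally show ?thesis by (simp only: P.chi_def minus_one(1))
next
  case (curly w p n)
  show ?thesis
    unfolding curly(1) bloch_class_curly[OF curly(2)] curly(3) P.Delta_period P.chi_def ..
qed

lemma chi_hat_hom: "chi_hat \<in> hom Cx Phat"
proof (rule homI)
  fix z assume "z \<in> carrier Cx"
  then show "chi_hat z \<in> carrier Phat" by (auto simp: Cx_def chi_hat_def carrier_Phat chi_rep_Zhat)
next
  fix z w assume "z \<in> carrier Cx" "w \<in> carrier Cx"
  then have zw: "z \<noteq> 0" "w \<noteq> 0" by (auto simp: Cx_def)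
  have "bloch_class (chi_rep (z * w)) = bloch_class (chi_rep z + chi_rep w)"
    using zw by (simp add: bloch_class_chi_rep bloch_class_simps P.chi_mult)
  then show "chi_hat (z \<otimes>\<^bsub>Cx\<^esub> w) = chi_hat z \<otimes>\<^bsub>Phat\<^esub> chi_hat w"
    using zw by (simp add: chi_hat_def Phat_mult chi_rep_Zhat Rhat_coset_eq bloch_class_eq_iff Cx_def)
qed

text \<open>Principal logarithms define a section \<open>lift\<close>. On generators x and
  \<open>lift (pihat_free x)\<close> differ by a value of \<open>P.Delta\<close>, hence always, and
  the second vanishes on the kernel.\<close>

lemma bloch_class_pihat_kernel:
  assumes "x \<in> carrier Zhat" "pihat_free x = 0"
  obtains w where "bloch_class x = P.Delta w"
proof -
  define lift where "lift = frag_extend (\<lambda>z. frag_of (Ln z, Ln (1 - z)))"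
  have lift: "lift 0 = 0" "lift (frag_of z) = frag_of (Ln z, Ln (1 - z))" "lift (a - b) = lift a - lift b" for z a b
    by (simp_all add: lift_def frag_extend_diff)
  have "Poly_Mapping.keys x \<subseteq> Chat" using assms(1) by (simp add: carrier_Zhat)
  then have "\<exists>w. bloch_class x - bloch_class (lift (pihat_free x)) = P.Delta w"
  proof (induction rule: frag_induction)
    case zero
    then show ?case by (intro exI[of _ 0]) (simp add: lift P.Delta_0)
  next
    case (one u)
    obtain a b where u: "u = (a, b)" by (cases u)
    then have ab: "exp a + exp b = 1" using one by (simp add: Chat_iff)
    then have b: "exp b = 1 - exp a" by (simp add: eq_diff_eq add.commute)
    then have nz: "1 - exp a \<noteq> 0" using exp_not_eq_zero[of b] by metis
    have "exp (Ln (exp a)) + exp (Ln (1 - exp a)) = 1" "exp a = exp (Ln (exp a))" "exp b = exp (Ln (1 - exp a))"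
      using b nz by simp_all
    then obtain w where "bloch_class (frag_of (a, b)) - bloch_class (frag_of (Ln (exp a), Ln (1 - exp a))) = P.Delta w"
      using P.Delta_range by blast
    then show ?case by (auto simp: u lift pihat_def)
  next
    case (diff a b)
    then obtain w w' where "bloch_class a - bloch_class (lift (pihat_free a)) = P.Delta w"
      "bloch_class b - bloch_class (lift (pihat_free b)) = P.Delta w'" by blast
    then have "bloch_class (a - b) - bloch_class (lift (pihat_free (a - b))) = P.Delta (w - w')"
      by (simp add: lift bloch_class_simps P.Delta_diff flip: \<open>_ = P.Delta w\<close>) (simp add: algebra_simps)
    then show ?case by blast
  qed
  then show thesis using assms(2) that by (auto simp: lift bloch_class_simps)
qed

lemma chi_hat_image: "chi_hat ` carrier Cx = kernel Phat PB pihat_star"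
proof
  show "chi_hat ` carrier Cx \<subseteq> kernel Phat PB pihat_star"
    using chi_hat_hom by (auto simp: kernel_def hom_def chi_hat_def pihat_star_coset Cx_def pihat_free_chi_rep PB_one)
  show "kernel Phat PB pihat_star \<subseteq> chi_hat ` carrier Cx"
  proof
    fix X assume X: "X \<in> kernel Phat PB pihat_star"
    then obtain x where x: "x \<in> carrier Zhat" "X = Rhat #>\<^bsub>Zhat\<^esub> x" by (auto simp: kernel_def carrier_Phat)
    then have "pihat_free x \<in> RP" using X by (simp add: kernel_def pihat_star_coset PB_one RP_coset_eq)
    \<comment> \<open>Subtracting a lift of the relation makes the image under
      \<open>pihat_free\<close> zero in the free group itself.\<close>
    then obtain y where y: "y \<in> Rhat" "pihat_free y = pihat_free x" using RP_lifts by blast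
    have "x - y \<in> carrier Zhat" "pihat_free (x - y) = 0"
      using Zhat_diff[OF x(1) Rhat_carrier[OF y(1)]] y(2) by simp_all
    then obtain w where "bloch_class (x - y) = P.Delta w" by (rule bloch_class_pihat_kernel)
    moreover have "bloch_class (x - y) = bloch_class x" using Rhat_uminus[OF y(1)] by (simp add: bloch_class_eq_iff)
    ultimately have "bloch_class x = bloch_class (chi_rep (exp (w / 2)))"
      by (simp add: bloch_class_chi_rep P.chi_exp)
    then have "X = chi_hat (exp (w / 2))" by (simp add: x chi_hat_def Rhat_coset_eq bloch_class_eq_iff)
    then show "X \<in> chi_hat ` carrier Cx" by (auto simp: Cx_def)
  qed
qed

lemma pihat_star_surj: "pihat_star ` carrier Phat = carrier PB"
proof
  show "pihat_star ` carrier Phat \<subseteq> carrier PB" using pihat_star_hom by (auto simp: hom_def)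
  show "carrier PB \<subseteq> pihat_star ` carrier Phat"
  proof
    fix Y assume "Y \<in> carrier PB"
    then obtain y where y: "y \<in> carrier ZP" "Y = RP #>\<^bsub>ZP\<^esub> y" unfolding carrier_PB by (rule imageE)
    from y(1)[unfolded carrier_ZP] have "\<exists>x \<in> carrier Zhat. pihat_free x = y"
    proof (induction rule: frag_induction)
      case zero then show ?case by (intro bexI[of _ 0]) (auto simp: carrier_Zhat)
    next
      case (one z)
      then show ?case
        by (intro bexI[of _ "frag_of (Ln z, Ln (1 - z))"]) (auto simp: frag_of_Zhat Chat_iff pihat_def)
    next
      case (diff a b)
      then show ?case by (metis Zhat_diff pihat_free_simps(4))
    qed
    then show "Y \<in> pihat_star ` carrier Phat" using y(2) by (force simp: carrier_Phat pihat_star_coset)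
  qed
qed

section \<open>The retraction and the splitting\<close>

lemma rogers_hom:
  obtains r where "r \<in> hom Phat Cx" "\<And>z. z \<noteq> 0 \<Longrightarrow> r (chi_hat z) = z"
proof -
  obtain c where c: "c \<noteq> 0" "\<And>w. w \<in> FT_hat \<Longrightarrow> rogers_five w = c" using rogers_five_constant by blast
  interpret Cx: comm_group Cx by (rule comm_group_Cx)
  have Cx: "carrier Cx = UNIV - {0}" "\<And>x y. x \<otimes>\<^bsub>Cx\<^esub> y = x * y" "\<one>\<^bsub>Cx\<^esub> = 1" by (simp_all add: Cx_def)
  have "(\<lambda>u. rogers u / c) ` Chat \<subseteq> carrier Cx" using c(1) by (auto simp: Cx)
  then obtain R where R: "R \<in> hom Zhat Cx" "\<And>u. u \<in> Chat \<Longrightarrow> R (frag_of u) = rogers u / c"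
    using Cx.free_Abelian_group_universal[of "\<lambda>u. rogers u / c" Chat] unfolding Zhat_def by metis
  have R_add: "R (x + y) = R x * R y" if "x \<in> carrier Zhat" "y \<in> carrier Zhat" for x y
    using R(1) that by (auto simp: hom_def Cx)
  have R_nz: "R x \<noteq> 0" if "x \<in> carrier Zhat" for x using R(1) that by (auto simp: hom_def Cx)
  have R_diff: "R (x - y) = R x / R y" if "x \<in> carrier Zhat" "y \<in> carrier Zhat" for x y
    using R_add[of "x - y" y] R_nz[OF that(2)] that Zhat_diff by (simp add: eq_divide_eq)
  have R_0: "R 0 = 1" using R_diff[of 0 0] R_nz[of 0] by (simp add: carrier_Zhat)
  have five: "R (five_term w) = 1" if w: "w \<in> FT_hat" for w
  proof -
    have C: "w $ i \<in> Chat" for i using w FT_hat_subset_FT_lift by (auto simp: FT_lift_def)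
    \<comment> \<open>Three positive and two negative terms leave exactly one factor 1/c.\<close>
    have "R (five_term w) = rogers_five w / c"
      unfolding five_term_def rogers_five_def using C c(1)
      by (simp add: R_add R_diff Zhat_add Zhat_diff frag_of_Zhat R(2)) (simp add: divide_simps)
    then show ?thesis using c w by simp
  qed
  have R_Rhat: "R x = 1" if "x \<in> Rhat" for x
    using that unfolding Rhat_def
  proof (induction rule: generate.induct)
    case (inv h)
    then obtain w where w: "w \<in> FT_hat" "h = five_term w" by blast
    then have h: "h \<in> carrier Zhat" using five_term_Zhat FT_hat_subset_FT_lift by blast
    then show ?case using R_diff[of 0 h] R_0 five w inv_Zhat[OF h] by (simp add: carrier_Zhat)
  next
    case (eng h1 h2)
    then show ?case using R_add Rhat_carrier unfolding Rhat_def by simp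
  qed (auto simp: R_0 five)
  obtain r where r: "r \<in> hom Phat Cx" "\<And>x. x \<in> carrier Zhat \<Longrightarrow> r (Rhat #>\<^bsub>Zhat\<^esub> x) = R x"
  proof (rule FactGroup_universal[OF R(1) normal_Rhat])
    fix x y assume "x \<in> carrier Zhat" "y \<in> carrier Zhat" "Rhat #>\<^bsub>Zhat\<^esub> x = Rhat #>\<^bsub>Zhat\<^esub> y"
    then show "R x = R y" using R_Rhat[of "x - y"] R_diff R_nz by (simp add: Rhat_coset_eq)
  qed (auto simp: Phat_def)
  \<comment> \<open>The constant c cancels in the difference, and \<open>rogers_shift\<close> leaves
    exp (u/2); at u = 2 Ln z, up to multiples of 4 pi i, this is z.\<close>
  have R_curly: "R (curly w p) = exp ((LogB w + 2 * pi * \<i> * of_int p) / 2)" if w: "w \<in> Cbar_cut" for w p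
  proof -
    let ?u = "LogB w + 2 * pi * \<i> * of_int p" and ?v = "Log1B w"
    have e: "exp ?u + exp ?v = 1" using curly_curve[OF w] .
    then have e': "exp ?u + exp (?v - 2 * pi * \<i>) = 1" by (simp only: exp_shift_2pi_i)
    have "(?u, ?v) \<in> Chat" "(?u, ?v - 2 * pi * \<i>) \<in> Chat"
      unfolding Chat_iff fst_conv snd_conv by (rule e e')+
    then have "R (curly w p) = (rogers (?u, ?v - 2 * pi * \<i>) / c) / (rogers (?u, ?v) / c)"
      unfolding curly_eq by (simp only: R_diff frag_of_Zhat R(2))
    also have "\<dots> = exp (?u / 2)" unfolding rogers_shift[OF e] using c(1) by simp
    finally show ?thesis .
  qed
  have "R (chi_rep z) = z" if "z \<noteq> 0" for z
    using that
  proof (cases rule: chi_rep_cases)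
    case minus_one
    have "R (chi_rep z) = exp (LogB (1 / 2, 0) / 2) / exp ((LogB (1 / 2, 0) + 2 * pi * \<i> * of_int (- 1)) / 2)"
      unfolding minus_one(2) kappa_rep_def using R_diff[OF curly_Zhat curly_Zhat] R_curly half_Cbar_cut by simp
    also have "\<dots> = exp (pi * \<i>)" unfolding exp_diff[symmetric] by (rule arg_cong[of _ _ exp]) (simp add: field_simps)
    finally show ?thesis using minus_one by simp
  next
    case (curly w p n)
    have "R (chi_rep z) = exp ((2 * Ln z + 4 * pi * \<i> * of_int n) / 2)"
      unfolding curly(1) R_curly[OF curly(2)] curly(3) ..
    also have "(2 * Ln z + 4 * pi * \<i> * of_int n) / 2 = Ln z + 2 * pi * \<i> * of_int n" by (simp add: field_simps)
    also have "exp \<dots> = z" using exp_integer_2pi[of "of_int n"] that by (simp add: exp_add mult_ac)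
    finally show ?thesis .
  qed (simp add: R_0)
  then have "r (chi_hat z) = z" if "z \<noteq> 0" for z
    using r(2)[OF chi_rep_Zhat[OF that]] that by (simp add: chi_hat_def)
  with r(1) show thesis by (rule that)
qed

text \<open>The endomorphism h x = x - i (r x), written additively, kills the image of i, which is
  the kernel of p, and satisfies p (h x) = p x. So h of any preimage under p defines the
  section.\<close>

lemma split_of_retraction:
  assumes "comm_group G" "group A" "group B" and i: "i \<in> hom A G" and p: "p \<in> hom G B"
    and exact: "i ` carrier A = kernel G B p" and surj: "p ` carrier G = carrier B"
    and r: "r \<in> hom G A" and ri: "\<And>a. a \<in> carrier A \<Longrightarrow> r (i a) = a"
  shows "\<exists>s \<in> hom B G. \<forall>y \<in> carrier B. p (s y) = y"
proof -
  interpret G: comm_group G by fact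
  interpret A: group A by fact
  interpret B: group B by fact
  interpret i: group_hom A G i using i by unfold_locales
  interpret p: group_hom G B p using p by unfold_locales
  interpret r: group_hom G A r using r by unfold_locales
  define h where "h = (\<lambda>x. x \<otimes>\<^bsub>G\<^esub> inv\<^bsub>G\<^esub> i (r x))"
  have h_closed: "h x \<in> carrier G" if "x \<in> carrier G" for x using that by (simp add: h_def)
  have h_mult: "h (x \<otimes>\<^bsub>G\<^esub> y) = h x \<otimes>\<^bsub>G\<^esub> h y" if "x \<in> carrier G" "y \<in> carrier G" for x y
    using that by (simp add: h_def G.inv_mult G.m_ac)
  have h_i: "h (i a) = \<one>\<^bsub>G\<^esub>" if "a \<in> carrier A" for a using that by (simp add: h_def ri)
  have pi: "p (i a) = \<one>\<^bsub>B\<^esub>" if "a \<in> carrier A" for a using exact that by (auto simp: kernel_def)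
  have ph: "p (h x) = p x" if "x \<in> carrier G" for x using that by (simp add: h_def pi)
  have h_eq: "h x = h y" if xy: "x \<in> carrier G" "y \<in> carrier G" "p x = p y" for x y
  proof -
    have "x \<otimes>\<^bsub>G\<^esub> inv\<^bsub>G\<^esub> y \<in> kernel G B p" using xy by (simp add: kernel_def)
    then obtain a where a: "a \<in> carrier A" "x \<otimes>\<^bsub>G\<^esub> inv\<^bsub>G\<^esub> y = i a" using exact by (metis imageE)
    then have "x = i a \<otimes>\<^bsub>G\<^esub> y" using xy by (metis G.inv_solve_right' i.hom_closed)
    then show ?thesis using h_mult[of "i a" y] h_i a xy h_closed by simp
  qed
  define t where "t = (\<lambda>y. SOME x. x \<in> carrier G \<and> p x = y)"
  have t: "t y \<in> carrier G" "p (t y) = y" if "y \<in> carrier B" for y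
  proof -
    have "\<exists>x. x \<in> carrier G \<and> p x = y" using surj that by (metis imageE)
    then have "t y \<in> carrier G \<and> p (t y) = y" unfolding t_def by (rule someI_ex)
    then show "t y \<in> carrier G" "p (t y) = y" by simp_all
  qed
  have "(\<lambda>y. h (t y)) \<in> hom B G"
  proof (rule homI)
    fix x y assume xy: "x \<in> carrier B" "y \<in> carrier B"
    have "h (t (x \<otimes>\<^bsub>B\<^esub> y)) = h (t x \<otimes>\<^bsub>G\<^esub> t y)" using xy t by (intro h_eq) auto
    then show "h (t (x \<otimes>\<^bsub>B\<^esub> y)) = h (t x) \<otimes>\<^bsub>G\<^esub> h (t y)" using h_mult t xy by simp
  qed (simp add: h_closed t)
  then show ?thesis using ph t by (intro bexI[of _ "\<lambda>y. h (t y)"]) auto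
qed

theorem theorem3p4:
  shows "chi_hat \<in> hom Cx Phat
    \<and> (\<forall>x \<in> Rhat. pihat_free x \<in> RP)
    \<and> pihat_star \<in> hom Phat PB
    \<and> kernel Cx Phat chi_hat = {1}
    \<and> chi_hat ` carrier Cx = kernel Phat PB pihat_star
    \<and> pihat_star ` carrier Phat = carrier PB
    \<and> (\<exists>r \<in> hom Phat Cx. \<forall>z \<in> carrier Cx. r (chi_hat z) = z)
    \<and> (\<exists>s \<in> hom PB Phat. \<forall>y \<in> carrier PB. pihat_star (s y) = y)"
proof -
  interpret Phat: comm_group Phat by (rule comm_group_Phat)
  interpret Cx: comm_group Cx by (rule comm_group_Cx)
  obtain r where r: "r \<in> hom Phat Cx" "\<And>z. z \<noteq> 0 \<Longrightarrow> r (chi_hat z) = z" using rogers_hom by blast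
  have Cx: "carrier Cx = UNIV - {0}" "\<one>\<^bsub>Cx\<^esub> = 1" by (simp_all add: Cx_def)
  interpret chi: group_hom Cx Phat chi_hat using chi_hat_hom by unfold_locales
  have "inj_on chi_hat (carrier Cx)" using r(2) by (metis Cx(1) DiffD2 inj_onI singletonI)
  then have "kernel Cx Phat chi_hat = {1}"
    using chi.inj_iff_trivial_ker Cx(2) by simp
  moreover have "\<exists>s \<in> hom PB Phat. \<forall>y \<in> carrier PB. pihat_star (s y) = y"
    by (rule split_of_retraction[OF comm_group_Phat Cx.is_group group_PB chi_hat_hom pihat_star_hom chi_hat_image pihat_star_surj r(1)])
      (simp add: r Cx)
  moreover have "\<exists>r \<in> hom Phat Cx. \<forall>z \<in> carrier Cx. r (chi_hat z) = z"
    using r by (intro bexI[of _ r]) (auto simp: Cx)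
  ultimately show ?thesis
    using chi_hat_hom pihat_free_Rhat pihat_star_hom chi_hat_image pihat_star_surj by blast
qed

end
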